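(* Let $T$ be a bimonad on a monoidal category $\mathcal{C}$. Any R-matrix $R$ for $T$ yields a braiding $\tau$ on $T\text{-}\mathcal{C}$ as follows: $$\tau_{(M,r),(N,s)}=(s\otimes r)R_{M,N}\colon(M,r)\otimes(N,s)\to(N,s)\otimes(M,r)$$ for any $T$-modules $(M,r)$ and $(N,s)$. This assignment gives a bijection between R-matrices for $T$ and braidings on $T\text{-}\mathcal{C}$.
   Context: Conventions: categories are small, monoidal categories $(\mathcal{C},\otimes,\mathbf 1)$ are strict; composition of $f$ followed by $g$ is written $gf$; "functorial" means natural. Monads: a monad on $\mathcal{C}$ is $(T,\mu\colon T^2\to T,\eta\colon 1_{\mathcal C}\to T)$ with $\mu_XT(\mu_X)=\mu_X\mu_{T(X)}$, $\mu_X\eta_{T(X)}=\mathrm{id}=\mu_XT(\eta_X)$. A $T$-module is $(M,r)$ with $r\colon T(M)\to M$, $rT(r)=r\mu_M$, $r\eta_M=\mathrm{id}_M$; morphisms $f\colon(M,r)\to(N,s)$ satisfy $fr=sT(f)$. $T\text{-}\mathcal{C}$ is the category of $T$-modules. Bimonads: a bimonad on a monoidal category $\mathcal{C}$ is a monad $T$ equipped with natural $T_2(X,Y)\colon T(X\otimes Y)\to T(X)\otimes T(Y)$ and $T_0\colon T(\mathbf 1)\to\mathbf 1$ with $(\mathrm{id}\otimes T_2(Y,Z))T_2(X,Y\otimes Z)=(T_2(X,Y)\otimes \mathrm{id})T_2(X\otimes Y,Z)$, $(\mathrm{id}\otimes T_0)T_2(X,\mathbf 1)=\mathrm{id}=(T_0\otimes\mathrm{id})T_2(\mathbf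 1,X)$, $T_2(X,Y)\mu_{X\otimes Y}=(\mu_X\otimes\mu_Y)T_2(T(X),T(Y))T(T_2(X,Y))$, $T_0\mu_{\mathbf 1}=T_0T(T_0)$, $T_2(X,Y)\eta_{X\otimes Y}=\eta_X\otimes\eta_Y$, $T_0\eta_{\mathbf 1}=\mathrm{id}_{\mathbf 1}$. Then $T\text{-}\mathcal{C}$ is monoidal with $(M,r)\otimes(N,s)=(M\otimes N,(r\otimes s)T_2(M,N))$ and unit $(\mathbf 1,T_0)$. A braiding on a monoidal category is a natural isomorphism $\tau_{X,Y}\colon X\otimes Y\to Y\otimes X$ with $\tau_{X,Y\otimes Z}=(\mathrm{id}_Y\otimes\tau_{X,Z})(\tau_{X,Y}\otimes\mathrm{id}_Z)$ and $\tau_{X\otimes Y,Z}=(\tau_{X,Z}\otimes\mathrm{id}_Y)(\mathrm{id}_X\otimes\tau_{Y,Z})$. R-matrices: an R-matrix for a bimonad $T$ is a natural family $R_{X,Y}\colon X\otimes Y\to T(Y)\otimes T(X)$ which is $*$-invertible, meaning that there is a natural family $R^{*-1}_{X,Y}\colon Y\otimes X\to T(X)\otimes T(Y)$ with $(\mu_X\otimes\mu_Y)R^{*-1}_{T(X),T(Y)}R_{X,Y}=\eta_X\otimes\eta_Y$ and $(\mu_Y\otimes\mu_X)R_{T(X),T(Y)}R^{*-1}_{X,Y}=\eta_Y\otimes\eta_X$, and such that for all objects $X,Y,Z$: (1) $(\mu_Y\otimes\mu_X)R_{T(X),T(Y)}T_2(X,Y)=(\mu_Y\otimes\mu_X)T_2(T(Y),T(X))T(R_{X,Y})$;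 (2) $(\mathrm{id}_{T(Z)}\otimes T_2(X,Y))R_{X\otimes Y,Z}=(\mu_Z\otimes\mathrm{id}_{T(X)\otimes T(Y)})(R_{X,T(Z)}\otimes\mathrm{id}_{T(Y)})(\mathrm{id}_X\otimes R_{Y,Z})$; (3) $(T_2(Y,Z)\otimes\mathrm{id}_{T(X)})R_{X,Y\otimes Z}=(\mathrm{id}_{T(Y)\otimes T(Z)}\otimes\mu_X)(\mathrm{id}_{T(Y)}\otimes R_{T(X),Z})(R_{X,Y}\otimes\mathrm{id}_Z)$. *)

theory Defs
  imports "HOL-Library.FuncSet"
begin

(* Small categories are given by hom-sets.  The hom-sets need not be disjoint, so that a morphism
   of modules over a monad can be literally a morphism of the underlying category; composition
   (and, below, the tensor product of morphisms) does not depend on the chosen source and target.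
   Every small category with disjoint hom-sets is of this form. *)

record ('o, 'm) category_data =
  Obj :: "'o set"
  Hom :: "'o \<Rightarrow> 'o \<Rightarrow> 'm set"
  Comp :: "'m \<Rightarrow> 'm \<Rightarrow> 'm" (infixl "\<cdot>\<index>" 65)  (* g \<cdot> f is f followed by g *)
  Id :: "'o \<Rightarrow> 'm"

record ('o, 'm) monoidal_data = "('o, 'm) category_data" +
  TensorO :: "'o \<Rightarrow> 'o \<Rightarrow> 'o" (infixr "\<odot>\<index>" 75)
  TensorM :: "'m \<Rightarrow> 'm \<Rightarrow> 'm" (infixr "\<otimes>\<index>" 75)
  UnitO :: "'o" ("\<one>\<index>")

locale category =
  fixes C (structure)
  assumes Hom_Obj: "f \<in> Hom C X Y \<Longrightarrow> X \<in> Obj C \<and> Y \<in> Obj C"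
    and Id_Hom: "X \<in> Obj C \<Longrightarrow> Id C X \<in> Hom C X X"
    and Comp_Hom: "\<lbrakk>f \<in> Hom C X Y; g \<in> Hom C Y Z\<rbrakk> \<Longrightarrow> g \<cdot> f \<in> Hom C X Z"
    and Comp_assoc: "\<lbrakk>f \<in> Hom C W X; g \<in> Hom C X Y; h \<in> Hom C Y Z\<rbrakk> \<Longrightarrow> (h \<cdot> g) \<cdot> f = h \<cdot> (g \<cdot> f)"
    and Comp_Id: "f \<in> Hom C X Y \<Longrightarrow> f \<cdot> Id C X = f"
    and Id_Comp: "f \<in> Hom C X Y \<Longrightarrow> Id C Y \<cdot> f = f"

definition iso :: "('o, 'm, 'z) category_data_scheme \<Rightarrow> 'o \<Rightarrow> 'o \<Rightarrow> 'm \<Rightarrow> bool" where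
  "iso C X Y f \<longleftrightarrow> f \<in> Hom C X Y \<and>
     (\<exists>g\<in>Hom C Y X. g \<cdot>\<^bsub>C\<^esub> f = Id C X \<and> f \<cdot>\<^bsub>C\<^esub> g = Id C Y)"

locale strict_monoidal_category = category C for C (structure) +
  assumes TensorO_Obj: "\<lbrakk>X \<in> Obj C; Y \<in> Obj C\<rbrakk> \<Longrightarrow> X \<odot> Y \<in> Obj C"
    and UnitO_Obj: "\<one> \<in> Obj C"
    and TensorM_Hom: "\<lbrakk>f \<in> Hom C X X'; g \<in> Hom C Y Y'\<rbrakk> \<Longrightarrow> f \<otimes> g \<in> Hom C (X \<odot> Y) (X' \<odot> Y')"
    and TensorM_Id: "\<lbrakk>X \<in> Obj C; Y \<in> Obj C\<rbrakk> \<Longrightarrow> Id C X \<otimes> Id C Y = Id C (X \<odot> Y)"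
    and TensorM_Comp: "\<lbrakk>f \<in> Hom C X X'; f' \<in> Hom C X' X''; g \<in> Hom C Y Y'; g' \<in> Hom C Y' Y''\<rbrakk>
      \<Longrightarrow> (f' \<cdot> f) \<otimes> (g' \<cdot> g) = (f' \<otimes> g') \<cdot> (f \<otimes> g)"
    and TensorO_assoc: "\<lbrakk>X \<in> Obj C; Y \<in> Obj C; Z \<in> Obj C\<rbrakk> \<Longrightarrow> (X \<odot> Y) \<odot> Z = X \<odot> (Y \<odot> Z)"
    and UnitO_left: "X \<in> Obj C \<Longrightarrow> \<one> \<odot> X = X"
    and UnitO_right: "X \<in> Obj C \<Longrightarrow> X \<odot> \<one> = X"
    and TensorM_assoc: "\<lbrakk>f \<in> Hom C X X'; g \<in> Hom C Y Y'; h \<in> Hom C Z Z'\<rbrakk>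
      \<Longrightarrow> (f \<otimes> g) \<otimes> h = f \<otimes> (g \<otimes> h)"
    and TensorM_unit_left: "f \<in> Hom C X Y \<Longrightarrow> Id C \<one> \<otimes> f = f"
    and TensorM_unit_right: "f \<in> Hom C X Y \<Longrightarrow> f \<otimes> Id C \<one> = f"

(* Braidings and R-matrices are families indexed by pairs of objects.  They are taken in
   the dependent product PiE, i.e. with a fixed value off the objects, so that two of them are equal
   iff they agree on all pairs of objects. *)

locale braiding = strict_monoidal_category C for C (structure) +
  fixes \<tau> :: "'a \<Rightarrow> 'a \<Rightarrow> 'b"
  assumes family: "\<tau> \<in> (\<Pi>\<^sub>E X\<in>Obj C. \<Pi>\<^sub>E Y\<in>Obj C. Hom C (X \<odot> Y) (Y \<odot> X))"
    and natural: "\<lbrakk>f \<in> Hom C X X'; g \<in> Hom C Y Y'\<rbrakk> \<Longrightarrow> (g \<otimes> f) \<cdot> \<tau> X Y = \<tau> X' Y' \<cdot> (f \<otimes> g)"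
    and isomorphism: "\<lbrakk>X \<in> Obj C; Y \<in> Obj C\<rbrakk> \<Longrightarrow> iso C (X \<odot> Y) (Y \<odot> X) (\<tau> X Y)"
    and hexagon_right: "\<lbrakk>X \<in> Obj C; Y \<in> Obj C; Z \<in> Obj C\<rbrakk>
      \<Longrightarrow> \<tau> X (Y \<odot> Z) = (Id C Y \<otimes> \<tau> X Z) \<cdot> (\<tau> X Y \<otimes> Id C Z)"
    and hexagon_left: "\<lbrakk>X \<in> Obj C; Y \<in> Obj C; Z \<in> Obj C\<rbrakk>
      \<Longrightarrow> \<tau> (X \<odot> Y) Z = (\<tau> X Z \<otimes> Id C Y) \<cdot> (Id C X \<otimes> \<tau> Y Z)"

record ('o, 'm) monad_data =
  MapO :: "'o \<Rightarrow> 'o"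
  MapM :: "'m \<Rightarrow> 'm"
  Mult :: "'o \<Rightarrow> 'm"  (* \<mu> *)
  Eta :: "'o \<Rightarrow> 'm"  (* \<eta> *)

record ('o, 'm) bimonad_data = "('o, 'm) monad_data" +
  Comult :: "'o \<Rightarrow> 'o \<Rightarrow> 'm"  (* T\<^sub>2 *)
  Counit :: "'m"  (* T\<^sub>0 *)

locale monad = category C for C (structure) +
  fixes T :: "('a, 'b, 'z) monad_data_scheme"
  assumes MapO_Obj: "X \<in> Obj C \<Longrightarrow> MapO T X \<in> Obj C"
    and MapM_Hom: "f \<in> Hom C X Y \<Longrightarrow> MapM T f \<in> Hom C (MapO T X) (MapO T Y)"
    and MapM_Id: "X \<in> Obj C \<Longrightarrow> MapM T (Id C X) = Id C (MapO T X)"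
    and MapM_Comp: "\<lbrakk>f \<in> Hom C X Y; g \<in> Hom C Y Z\<rbrakk> \<Longrightarrow> MapM T (g \<cdot> f) = MapM T g \<cdot> MapM T f"
    and Mult_Hom: "X \<in> Obj C \<Longrightarrow> Mult T X \<in> Hom C (MapO T (MapO T X)) (MapO T X)"
    and Mult_natural: "f \<in> Hom C X Y \<Longrightarrow> MapM T f \<cdot> Mult T X = Mult T Y \<cdot> MapM T (MapM T f)"
    and Eta_Hom: "X \<in> Obj C \<Longrightarrow> Eta T X \<in> Hom C X (MapO T X)"
    and Eta_natural: "f \<in> Hom C X Y \<Longrightarrow> MapM T f \<cdot> Eta T X = Eta T Y \<cdot> f"
    and Mult_assoc: "X \<in> Obj C \<Longrightarrow> Mult T X \<cdot> MapM T (Mult T X) = Mult T X \<cdot> Mult T (MapO T X)"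
    and Mult_Eta_left: "X \<in> Obj C \<Longrightarrow> Mult T X \<cdot> Eta T (MapO T X) = Id C (MapO T X)"
    and Mult_Eta_right: "X \<in> Obj C \<Longrightarrow> Mult T X \<cdot> MapM T (Eta T X) = Id C (MapO T X)"

locale bimonad = strict_monoidal_category C + monad C T for C (structure) and
    T :: "('a, 'b, 'z) bimonad_data_scheme" +
  assumes Comult_Hom: "\<lbrakk>X \<in> Obj C; Y \<in> Obj C\<rbrakk>
      \<Longrightarrow> Comult T X Y \<in> Hom C (MapO T (X \<odot> Y)) (MapO T X \<odot> MapO T Y)"
    and Comult_natural: "\<lbrakk>f \<in> Hom C X X'; g \<in> Hom C Y Y'\<rbrakk>
      \<Longrightarrow> (MapM T f \<otimes> MapM T g) \<cdot> Comult T X Y = Comult T X' Y' \<cdot> MapM T (f \<otimes> g)"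
    and Counit_Hom: "Counit T \<in> Hom C (MapO T \<one>) \<one>"
    and Comult_coassoc: "\<lbrakk>X \<in> Obj C; Y \<in> Obj C; Z \<in> Obj C\<rbrakk>
      \<Longrightarrow> (Id C (MapO T X) \<otimes> Comult T Y Z) \<cdot> Comult T X (Y \<odot> Z)
        = (Comult T X Y \<otimes> Id C (MapO T Z)) \<cdot> Comult T (X \<odot> Y) Z"
    and Counit_right: "X \<in> Obj C \<Longrightarrow> (Id C (MapO T X) \<otimes> Counit T) \<cdot> Comult T X \<one> = Id C (MapO T X)"
    and Counit_left: "X \<in> Obj C \<Longrightarrow> (Counit T \<otimes> Id C (MapO T X)) \<cdot> Comult T \<one> X = Id C (MapO T X)"
    and Comult_Mult: "\<lbrakk>X \<in> Obj C; Y \<in> Obj C\<rbrakk>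
      \<Longrightarrow> Comult T X Y \<cdot> Mult T (X \<odot> Y)
        = (Mult T X \<otimes> Mult T Y) \<cdot> Comult T (MapO T X) (MapO T Y) \<cdot> MapM T (Comult T X Y)"
    and Counit_Mult: "Counit T \<cdot> Mult T \<one> = Counit T \<cdot> MapM T (Counit T)"
    and Comult_Eta: "\<lbrakk>X \<in> Obj C; Y \<in> Obj C\<rbrakk> \<Longrightarrow> Comult T X Y \<cdot> Eta T (X \<odot> Y) = Eta T X \<otimes> Eta T Y"
    and Counit_Eta: "Counit T \<cdot> Eta T \<one> = Id C \<one>"

definition modules ::
  "('o, 'm, 'y) category_data_scheme \<Rightarrow> ('o, 'm, 'z) monad_data_scheme \<Rightarrow> ('o \<times> 'm) set" where
  "modules C T = {(M, r). M \<in> Obj C \<and> r \<in> Hom C (MapO T M) M \<and>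
     r \<cdot>\<^bsub>C\<^esub> MapM T r = r \<cdot>\<^bsub>C\<^esub> Mult T M \<and> r \<cdot>\<^bsub>C\<^esub> Eta T M = Id C M}"

definition module_category ::
  "('o, 'm, 'y) monoidal_data_scheme \<Rightarrow> ('o, 'm, 'z) bimonad_data_scheme
    \<Rightarrow> ('o \<times> 'm, 'm) monoidal_data" where
  "module_category C T =
    \<lparr>Obj = modules C T,
     Hom = (\<lambda>(M, r) (N, s). {f \<in> Hom C M N. (M, r) \<in> modules C T \<and> (N, s) \<in> modules C T \<and>
              f \<cdot>\<^bsub>C\<^esub> r = s \<cdot>\<^bsub>C\<^esub> MapM T f}),
     Comp = Comp C,
     Id = (\<lambda>(M, r). Id C M),
     TensorO = (\<lambda>(M, r) (N, s). (M \<odot>\<^bsub>C\<^esub> N, (r \<otimes>\<^bsub>C\<^esub> s) \<cdot>\<^bsub>C\<^esub> Comult T M N)),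
     TensorM = TensorM C,
     UnitO = (\<one>\<^bsub>C\<^esub>, Counit T)\<rparr>"

context bimonad begin

lemma modulesD:
  assumes "(M, r) \<in> modules C T"
  shows "M \<in> Obj C" "r \<in> Hom C (MapO T M) M" "r \<cdot> MapM T r = r \<cdot> Mult T M" "r \<cdot> Eta T M = Id C M"
  using assms by (auto simp: modules_def)

lemma tensor_module:
  assumes m: "(M, r) \<in> modules C T" and n: "(N, s) \<in> modules C T"
  shows "(M \<odot> N, (r \<otimes> s) \<cdot> Comult T M N) \<in> modules C T"
proof -
  note M = modulesD[OF m] and N = modulesD[OF n]
  let ?T = "MapO T" and ?F = "MapM T" and ?D = "Comult T"
  note rs = TensorM_Hom[OF M(2) N(2)]
  note D = Comult_Hom[OF M(1) N(1)]
  have MN: "M \<odot> N \<in> Obj C" and TM: "?T M \<in> Obj C" and TN: "?T N \<in> Obj C"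
    using M N TensorO_Obj MapO_Obj by auto
  note DT = Comult_Hom[OF TM TN]
  have h: "(r \<otimes> s) \<cdot> ?D M N \<in> Hom C (?T (M \<odot> N)) (M \<odot> N)"
    using Comp_Hom[OF D rs] .
  have e: "((r \<otimes> s) \<cdot> ?D M N) \<cdot> Eta T (M \<odot> N) = Id C (M \<odot> N)"
    using Comp_assoc[OF Eta_Hom[OF MN] D rs] Comult_Eta[OF M(1) N(1)]
      TensorM_Comp[OF Eta_Hom[OF M(1)] M(2) Eta_Hom[OF N(1)] N(2)] M N TensorM_Id by simp
  note TD = MapM_Hom[OF D] and Trs = MapM_Hom[OF rs]
  note Frs = TensorM_Hom[OF MapM_Hom[OF M(2)] MapM_Hom[OF N(2)]]
  note mu = TensorM_Hom[OF Mult_Hom[OF M(1)] Mult_Hom[OF N(1)]]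
  have "((r \<otimes> s) \<cdot> ?D M N) \<cdot> ?F ((r \<otimes> s) \<cdot> ?D M N)
     = ((r \<otimes> s) \<cdot> ?D M N) \<cdot> (?F (r \<otimes> s) \<cdot> ?F (?D M N))"
    using MapM_Comp[OF D rs] by simp
  also have "\<dots> = (r \<otimes> s) \<cdot> ((?D M N \<cdot> ?F (r \<otimes> s)) \<cdot> ?F (?D M N))"
    using Comp_assoc[OF Comp_Hom[OF TD Trs] D rs] Comp_assoc[OF TD Trs D] by simp
  also have "\<dots> = (r \<otimes> s) \<cdot> (((?F r \<otimes> ?F s) \<cdot> ?D (?T M) (?T N)) \<cdot> ?F (?D M N))"
    using Comult_natural[OF M(2) N(2)] by simp
  also have "\<dots> = ((r \<otimes> s) \<cdot> (?F r \<otimes> ?F s)) \<cdot> (?D (?T M) (?T N) \<cdot> ?F (?D M N))"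
    using Comp_assoc[OF TD DT Frs] Comp_assoc[OF Comp_Hom[OF TD DT] Frs rs] by simp
  also have "\<dots> = ((r \<otimes> s) \<cdot> (Mult T M \<otimes> Mult T N)) \<cdot> (?D (?T M) (?T N) \<cdot> ?F (?D M N))"
    using TensorM_Comp[OF MapM_Hom[OF M(2)] M(2) MapM_Hom[OF N(2)] N(2)]
      TensorM_Comp[OF Mult_Hom[OF M(1)] M(2) Mult_Hom[OF N(1)] N(2)] M N by simp
  also have "\<dots> = (r \<otimes> s) \<cdot> (?D M N \<cdot> Mult T (M \<odot> N))"
    using Comult_Mult[OF M(1) N(1)] Comp_assoc[OF TD DT mu]
      Comp_assoc[OF Comp_Hom[OF TD DT] mu rs] by simp
  also have "\<dots> = ((r \<otimes> s) \<cdot> ?D M N) \<cdot> Mult T (M \<odot> N)"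
    using Comp_assoc[OF Mult_Hom[OF MN] D rs] by simp
  finally show ?thesis using MN h e by (simp add: modules_def)
qed

lemma unit_module: "(\<one>, Counit T) \<in> modules C T"
  using UnitO_Obj Counit_Hom Counit_Mult Counit_Eta by (simp add: modules_def)

lemma strict_monoidal_modules: "strict_monoidal_category (module_category C T)"
proof (unfold_locales, goal_cases)
  case (1 f X Y) then show ?case by (auto split: prod.splits simp: module_category_def)
next
  case (2 X) then show ?case
    apply (cases X) by (auto split: prod.splits simp: module_category_def modules_def Id_Hom Id_Comp Comp_Id MapM_Id)
next
  case (3 f X Y g Z)
  obtain M r N s P t where e: "X = (M,r)" "Y = (N,s)" "Z = (P,t)" by (metis surj_pair)
  have f: "f \<in> Hom C M N" "f \<cdot> r = s \<cdot> MapM T f" "(M,r) \<in> modules C T" "(N,s) \<in> modules C T"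
   and g: "g \<in> Hom C N P" "g \<cdot> s = t \<cdot> MapM T g" "(P,t) \<in> modules C T"
    using 3 e by (auto split: prod.splits simp: module_category_def)
  note M = modulesD[OF f(3)] and N = modulesD[OF f(4)] and P = modulesD[OF g(3)]
  have "(g \<cdot> f) \<cdot> r = g \<cdot> (s \<cdot> MapM T f)" using Comp_assoc[OF M(2) f(1) g(1)] f by simp
  also have "\<dots> = t \<cdot> MapM T (g \<cdot> f)"
    using Comp_assoc[OF MapM_Hom[OF f(1)] N(2) g(1)] g(2)
     Comp_assoc[OF MapM_Hom[OF f(1)] MapM_Hom[OF g(1)] P(2)] MapM_Comp[OF f(1) g(1)] by simp
  finally show ?case using f g Comp_Hom[OF f(1) g(1)] e by (simp add: module_category_def)
next
  case (4 f W X g Y h Z) then show ?case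
    by (auto split: prod.splits simp: module_category_def intro: Comp_assoc)
next
  case (5 f X Y) then show ?case by (auto split: prod.splits simp: module_category_def intro: Comp_Id)
next
  case (6 f X Y) then show ?case by (auto split: prod.splits simp: module_category_def intro: Id_Comp)
next
  case (7 X Y) then show ?case by (auto split: prod.splits simp: module_category_def intro: tensor_module)
next
  case 8 show ?case by (auto split: prod.splits simp: module_category_def intro: unit_module)
next
  case (9 f X X' g Y Y')
  obtain M r N s P t Q u where e: "X = (M,r)" "X' = (N,s)" "Y = (P,t)" "Y' = (Q,u)" by (metis surj_pair)
  have f: "f \<in> Hom C M N" "f \<cdot> r = s \<cdot> MapM T f" "(M,r) \<in> modules C T" "(N,s) \<in> modules C T"
   and g: "g \<in> Hom C P Q" "g \<cdot> t = u \<cdot> MapM T g" "(P,t) \<in> modules C T" "(Q,u) \<in> modules C T"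
    using 9 e by (auto split: prod.splits simp: module_category_def)
  note M = modulesD[OF f(3)] and N = modulesD[OF f(4)] and P = modulesD[OF g(3)] and Q = modulesD[OF g(4)]
  note fg = TensorM_Hom[OF f(1) g(1)]
  have "(f \<otimes> g) \<cdot> ((r \<otimes> t) \<cdot> Comult T M P) = ((f \<otimes> g) \<cdot> (r \<otimes> t)) \<cdot> Comult T M P"
    using Comp_assoc[OF Comult_Hom[OF M(1) P(1)] TensorM_Hom[OF M(2) P(2)] fg] by simp
  also have "\<dots> = ((s \<otimes> u) \<cdot> (MapM T f \<otimes> MapM T g)) \<cdot> Comult T M P"
    using TensorM_Comp[OF M(2) f(1) P(2) g(1)]
      TensorM_Comp[OF MapM_Hom[OF f(1)] N(2) MapM_Hom[OF g(1)] Q(2)] f g by simp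
  also have "\<dots> = (s \<otimes> u) \<cdot> (Comult T N Q \<cdot> MapM T (f \<otimes> g))"
    using Comp_assoc[OF Comult_Hom[OF M(1) P(1)] TensorM_Hom[OF MapM_Hom[OF f(1)] MapM_Hom[OF g(1)]] TensorM_Hom[OF N(2) Q(2)]]
     Comult_natural[OF f(1) g(1)] by simp
  also have "\<dots> = ((s \<otimes> u) \<cdot> Comult T N Q) \<cdot> MapM T (f \<otimes> g)"
    using Comp_assoc[OF MapM_Hom[OF fg] Comult_Hom[OF N(1) Q(1)] TensorM_Hom[OF N(2) Q(2)]] by simp
  finally show ?case using f g fg e tensor_module by (simp add: module_category_def)
next
  case (10 X Y) then show ?case
    by (auto split: prod.splits simp: module_category_def modules_def TensorM_Id)
next
  case (11 f X X' f' X'' g Y Y' g' Y'') then show ?case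
    by (auto split: prod.splits simp: module_category_def intro: TensorM_Comp)
next
  case (12 X Y Z)
  obtain M r N s P t where e: "X = (M,r)" "Y = (N,s)" "Z = (P,t)" by (metis surj_pair)
  have "(M,r) \<in> modules C T" "(N,s) \<in> modules C T" "(P,t) \<in> modules C T"
    using 12 e by (auto split: prod.splits simp: module_category_def)
  note M = modulesD[OF this(1)] and N = modulesD[OF this(2)] and P = modulesD[OF this(3)]
  let ?D = "Comult T"
  note DMN = Comult_Hom[OF M(1) N(1)] and DNP = Comult_Hom[OF N(1) P(1)]
  note o = MapO_Obj[OF M(1)] MapO_Obj[OF N(1)] MapO_Obj[OF P(1)]
  note D1 = Comult_Hom[OF TensorO_Obj[OF M(1) N(1)] P(1)]
  note D2 = Comult_Hom[OF M(1) TensorO_Obj[OF N(1) P(1)]]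
  note rs = TensorM_Hom[OF M(2) N(2)] and st = TensorM_Hom[OF N(2) P(2)]
  have a1: "((r \<otimes> s) \<cdot> ?D M N) \<otimes> t = ((r \<otimes> s) \<otimes> t) \<cdot> (?D M N \<otimes> Id C (MapO T P))"
    using TensorM_Comp[OF DMN rs Id_Hom[OF o(3)] P(2)] Comp_Id[OF P(2)] by simp
  have a2: "r \<otimes> ((s \<otimes> t) \<cdot> ?D N P) = (r \<otimes> (s \<otimes> t)) \<cdot> (Id C (MapO T M) \<otimes> ?D N P)"
    using TensorM_Comp[OF Id_Hom[OF o(1)] M(2) DNP st] Comp_Id[OF M(2)] by simp
  have "(((r \<otimes> s) \<cdot> ?D M N) \<otimes> t) \<cdot> ?D (M \<odot> N) P
    = ((r \<otimes> s) \<otimes> t) \<cdot> ((?D M N \<otimes> Id C (MapO T P)) \<cdot> ?D (M \<odot> N) P)"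
    unfolding a1 using Comp_assoc[OF D1 TensorM_Hom[OF DMN Id_Hom[OF o(3)]] TensorM_Hom[OF rs P(2)]] .
  also have "\<dots> = (r \<otimes> (s \<otimes> t)) \<cdot> ((Id C (MapO T M) \<otimes> ?D N P) \<cdot> ?D M (N \<odot> P))"
    using Comult_coassoc[OF M(1) N(1) P(1)] TensorM_assoc[OF M(2) N(2) P(2)] by simp
  also have "\<dots> = (r \<otimes> ((s \<otimes> t) \<cdot> ?D N P)) \<cdot> ?D M (N \<odot> P)"
    unfolding a2 using Comp_assoc[OF D2 TensorM_Hom[OF Id_Hom[OF o(1)] DNP] TensorM_Hom[OF M(2) st]] by simp
  finally show ?case using e TensorO_assoc[OF M(1) N(1) P(1)] by (simp add: module_category_def)
next
  case (13 X)
  obtain M r where e: "X = (M,r)" by (metis surj_pair)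
  have "(M,r) \<in> modules C T" using 13 e by (auto split: prod.splits simp: module_category_def)
  note M = modulesD[OF this]
  have a: "Counit T \<otimes> r = (Id C \<one> \<otimes> r) \<cdot> (Counit T \<otimes> Id C (MapO T M))"
    using TensorM_Comp[OF Counit_Hom Id_Hom[OF UnitO_Obj] Id_Hom[OF MapO_Obj[OF M(1)]] M(2)]
      Comp_Id[OF M(2)] Id_Comp[OF Counit_Hom] by simp
  have "(Counit T \<otimes> r) \<cdot> Comult T \<one> M = r"
    unfolding a
    using Comp_assoc[OF Comult_Hom[OF UnitO_Obj M(1)] TensorM_Hom[OF Counit_Hom Id_Hom[OF MapO_Obj[OF M(1)]]] TensorM_Hom[OF Id_Hom[OF UnitO_Obj] M(2)]]
     Counit_left[OF M(1)] TensorM_unit_left[OF M(2)] Comp_Id[OF M(2)] by simp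
  then show ?case using e UnitO_left[OF M(1)] by (simp add: module_category_def)
next
  case (14 X)
  obtain M r where e: "X = (M,r)" by (metis surj_pair)
  have "(M,r) \<in> modules C T" using 14 e by (auto split: prod.splits simp: module_category_def)
  note M = modulesD[OF this]
  have a: "r \<otimes> Counit T = (r \<otimes> Id C \<one>) \<cdot> (Id C (MapO T M) \<otimes> Counit T)"
    using TensorM_Comp[OF Id_Hom[OF MapO_Obj[OF M(1)]] M(2) Counit_Hom Id_Hom[OF UnitO_Obj]]
      Comp_Id[OF M(2)] Id_Comp[OF Counit_Hom] by simp
  have "(r \<otimes> Counit T) \<cdot> Comult T M \<one> = r"
    unfolding a
    using Comp_assoc[OF Comult_Hom[OF M(1) UnitO_Obj] TensorM_Hom[OF Id_Hom[OF MapO_Obj[OF M(1)]] Counit_Hom] TensorM_Hom[OF M(2) Id_Hom[OF UnitO_Obj]]]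
     Counit_right[OF M(1)] TensorM_unit_right[OF M(2)] Comp_Id[OF M(2)] by simp
  then show ?case using e UnitO_right[OF M(1)] by (simp add: module_category_def)
next
  case (15 f X X' g Y Y' h Z Z') then show ?case
    by (auto split: prod.splits simp: module_category_def intro: TensorM_assoc)
next
  case (16 f X Y) then show ?case by (auto split: prod.splits simp: module_category_def intro: TensorM_unit_left)
next
  case (17 f X Y) then show ?case by (auto split: prod.splits simp: module_category_def intro: TensorM_unit_right)
qed

end

locale R_matrix = bimonad C T for C (structure) and T +
  fixes R :: "'a \<Rightarrow> 'a \<Rightarrow> 'b"
  assumes family: "R \<in> (\<Pi>\<^sub>E X\<in>Obj C. \<Pi>\<^sub>E Y\<in>Obj C. Hom C (X \<odot> Y) (MapO T Y \<odot> MapO T X))"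
    and natural: "\<lbrakk>f \<in> Hom C X X'; g \<in> Hom C Y Y'\<rbrakk>
      \<Longrightarrow> (MapM T g \<otimes> MapM T f) \<cdot> R X Y = R X' Y' \<cdot> (f \<otimes> g)"
    and star_invertible: "\<exists>R'.
      (\<forall>X\<in>Obj C. \<forall>Y\<in>Obj C. R' X Y \<in> Hom C (Y \<odot> X) (MapO T X \<odot> MapO T Y)) \<and>
      (\<forall>X X' Y Y'. \<forall>f\<in>Hom C X X'. \<forall>g\<in>Hom C Y Y'.
         (MapM T f \<otimes> MapM T g) \<cdot> R' X Y = R' X' Y' \<cdot> (g \<otimes> f)) \<and>
      (\<forall>X\<in>Obj C. \<forall>Y\<in>Obj C.
         (Mult T X \<otimes> Mult T Y) \<cdot> R' (MapO T X) (MapO T Y) \<cdot> R X Y = Eta T X \<otimes> Eta T Y \<and>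
         (Mult T Y \<otimes> Mult T X) \<cdot> R (MapO T X) (MapO T Y) \<cdot> R' X Y = Eta T Y \<otimes> Eta T X)"
    and R_Comult: "\<lbrakk>X \<in> Obj C; Y \<in> Obj C\<rbrakk>
      \<Longrightarrow> (Mult T Y \<otimes> Mult T X) \<cdot> R (MapO T X) (MapO T Y) \<cdot> Comult T X Y
        = (Mult T Y \<otimes> Mult T X) \<cdot> Comult T (MapO T Y) (MapO T X) \<cdot> MapM T (R X Y)"
    and R_tensor_left: "\<lbrakk>X \<in> Obj C; Y \<in> Obj C; Z \<in> Obj C\<rbrakk>
      \<Longrightarrow> (Id C (MapO T Z) \<otimes> Comult T X Y) \<cdot> R (X \<odot> Y) Z
        = (Mult T Z \<otimes> Id C (MapO T X \<odot> MapO T Y)) \<cdot> (R X (MapO T Z) \<otimes> Id C (MapO T Y))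
          \<cdot> (Id C X \<otimes> R Y Z)"
    and R_tensor_right: "\<lbrakk>X \<in> Obj C; Y \<in> Obj C; Z \<in> Obj C\<rbrakk>
      \<Longrightarrow> (Comult T Y Z \<otimes> Id C (MapO T X)) \<cdot> R X (Y \<odot> Z)
        = (Id C (MapO T Y \<odot> MapO T Z) \<otimes> Mult T X) \<cdot> (Id C (MapO T Y) \<otimes> R (MapO T X) Z)
          \<cdot> (R X Y \<otimes> Id C Z)"

definition braiding_of ::
  "('o, 'm, 'y) monoidal_data_scheme \<Rightarrow> ('o, 'm, 'z) bimonad_data_scheme
    \<Rightarrow> ('o \<Rightarrow> 'o \<Rightarrow> 'm) \<Rightarrow> 'o \<times> 'm \<Rightarrow> 'o \<times> 'm \<Rightarrow> 'm" where
  "braiding_of C T R =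
    restrict (\<lambda>(M, r). restrict (\<lambda>(N, s). (s \<otimes>\<^bsub>C\<^esub> r) \<cdot>\<^bsub>C\<^esub> R M N) (modules C T)) (modules C T)"

end

(* Write F X = (T X, mu_X) for the free module.  The inverse assignment is
   R_{X,Y} = tau_{F X, F Y} (eta_X \<otimes> eta_Y).  Every action r : F M -> (M, r) is a morphism of
   modules, so naturality of tau gives (s \<otimes> r) R_{M,N} = tau_{(M,r),(N,s)}, and conversely naturality
   of R and the unit laws recover R from its braiding.  Under this correspondence, linearity of
   tau is axiom (1), the hexagons are axioms (2) and (3) because T_2 : F(X \<otimes> Y) -> F X \<otimes> F Y is
   a morphism of modules, and the star-inverse of R comes from the inverse of tau. *)

theory Submission
  imports Defs
begin

text \<open>The obstacle is that \<open>F X \<otimes> F Y\<close> is in general not the free module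
  on \<open>X \<otimes> Y\<close>, so the free-forgetful adjunction alone does not recover
  \<open>\<tau>\<close> on free modules from its restriction along
  \<open>\<eta> \<otimes> \<eta>\<close>. Naturality in each variable separately does: applied to
  the module morphisms \<open>\<mu>_X : F (T X) -> F X\<close> and \<open>\<mu>_Y\<close>, and using
  \<open>\<mu> \<eta> = id\<close>, it gives
  \<open>(\<mu>_Y \<otimes> \<mu>_X) R_{T X, T Y} = \<tau>_{F X, F Y}\<close>. This identity
  explains the multiplications in the R-matrix axioms and in star-invertibility: they are what turns
  a composite of values of R into a composite of braidings of free modules. Each axiom for R thus
  becomes a property of the braiding on free modules, restricted along units or composed with the
  comultiplication; in the other direction the actions on arbitrary modules absorb the
  multiplications through \<open>r \<mu> = r T(r)\<close>.\<close>

section \<open>Interchange in a strict monoidal category\<close>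

context strict_monoidal_category begin

text \<open>Associativity and interchange fused into one rewriting step, with a further map
  \<open>h\<close> at the right end. Its main use is to exchange \<open>r T(r)\<close> and
  \<open>r \<mu>\<close> inside a tensor product in the middle of a composite.\<close>

lemma tensor_comp_comp:
  assumes "h \<in> Hom C W (X \<odot> Y)" "f \<in> Hom C X X'" "f' \<in> Hom C X' X''" "g \<in> Hom C Y Y'" "g' \<in> Hom C Y' Y''"
  shows "(f' \<otimes> g') \<cdot> ((f \<otimes> g) \<cdot> h) = ((f' \<cdot> f) \<otimes> (g' \<cdot> g)) \<cdot> h"
  using Comp_assoc[OF assms(1) TensorM_Hom[OF assms(2,4)] TensorM_Hom[OF assms(3,5)]]
    TensorM_Comp[OF assms(2-5)] by simp

text \<open>The two versions differ in whether \<open>g\<close> travels with the outer or the inner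
  factor; the other factor then receives an identity on the source or on the target of
  \<open>g\<close>.\<close>

lemma tensor_comp_left:
  assumes "f \<in> Hom C X X'" "f' \<in> Hom C X' X''" "g \<in> Hom C Y Y'"
  shows "(f' \<cdot> f) \<otimes> g = (f' \<otimes> g) \<cdot> (f \<otimes> Id C Y)" "(f' \<cdot> f) \<otimes> g = (f' \<otimes> Id C Y') \<cdot> (f \<otimes> g)"
proof -
  have Y: "Y \<in> Obj C" "Y' \<in> Obj C" using Hom_Obj assms(3) by auto
  show "(f' \<cdot> f) \<otimes> g = (f' \<otimes> g) \<cdot> (f \<otimes> Id C Y)"
    using TensorM_Comp[OF assms(1,2) Id_Hom[OF Y(1)] assms(3)] Comp_Id[OF assms(3)] by simp
  show "(f' \<cdot> f) \<otimes> g = (f' \<otimes> Id C Y') \<cdot> (f \<otimes> g)"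
    using TensorM_Comp[OF assms(1,2) assms(3) Id_Hom[OF Y(2)]] Id_Comp[OF assms(3)] by simp
qed

lemma tensor_comp_right:
  assumes "f \<in> Hom C X X'" "f' \<in> Hom C X' X''" "g \<in> Hom C Y Y'"
  shows "g \<otimes> (f' \<cdot> f) = (g \<otimes> f') \<cdot> (Id C Y \<otimes> f)" "g \<otimes> (f' \<cdot> f) = (Id C Y' \<otimes> f') \<cdot> (g \<otimes> f)"
proof -
  have Y: "Y \<in> Obj C" "Y' \<in> Obj C" using Hom_Obj assms(3) by auto
  show "g \<otimes> (f' \<cdot> f) = (g \<otimes> f') \<cdot> (Id C Y \<otimes> f)"
    using TensorM_Comp[OF Id_Hom[OF Y(1)] assms(3) assms(1,2)] Comp_Id[OF assms(3)] by simp
  show "g \<otimes> (f' \<cdot> f) = (Id C Y' \<otimes> f') \<cdot> (g \<otimes> f)"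
    using TensorM_Comp[OF assms(3) Id_Hom[OF Y(2)] assms(1,2)] Id_Comp[OF assms(3)] by simp
qed

end

lemma (in braiding) braiding_Hom: "\<lbrakk>X \<in> Obj C; Y \<in> Obj C\<rbrakk> \<Longrightarrow> \<tau> X Y \<in> Hom C (X \<odot> Y) (Y \<odot> X)"
  by (rule PiE_mem[OF PiE_mem[OF family]])

section \<open>Free modules and morphisms of modules\<close>

lemma module_category_simps [simp]:
  "Obj (module_category C T) = modules C T"
  "Comp (module_category C T) = Comp C"
  "Id (module_category C T) (M, r) = Id C M"
  "TensorO (module_category C T) (M, r) (N, s) = (M \<odot>\<^bsub>C\<^esub> N, (r \<otimes>\<^bsub>C\<^esub> s) \<cdot>\<^bsub>C\<^esub> Comult T M N)"
  "TensorM (module_category C T) = TensorM C"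
  by (simp_all add: module_category_def)

lemma module_category_Hom:
  "f \<in> Hom (module_category C T) (M, r) (N, s) \<longleftrightarrow>
    f \<in> Hom C M N \<and> (M, r) \<in> modules C T \<and> (N, s) \<in> modules C T \<and> f \<cdot>\<^bsub>C\<^esub> r = s \<cdot>\<^bsub>C\<^esub> MapM T f"
  by (simp add: module_category_def)

definition free_module :: "('o, 'm, 'z) monad_data_scheme \<Rightarrow> 'o \<Rightarrow> 'o \<times> 'm" where
  "free_module T X = (MapO T X, Mult T X)"

context bimonad begin

lemma free_module_in_modules: "X \<in> Obj C \<Longrightarrow> free_module T X \<in> modules C T"
  by (simp add: free_module_def modules_def MapO_Obj Mult_Hom Mult_assoc Mult_Eta_left)

text \<open>Linearity of the action is its associativity law read as an equation of maps out of
  \<open>T (T M)\<close>. This is the counit of the free-forgetful adjunction.\<close>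

lemma action_module_hom:
  assumes "(M, r) \<in> modules C T"
  shows "r \<in> Hom (module_category C T) (free_module T M) (M, r)"
  using assms modulesD[OF assms] free_module_in_modules[of M]
  by (simp add: module_category_Hom free_module_def)

lemma MapM_module_hom:
  assumes "f \<in> Hom C X Y"
  shows "MapM T f \<in> Hom (module_category C T) (free_module T X) (free_module T Y)"
  using assms Hom_Obj[OF assms] free_module_in_modules MapM_Hom Mult_natural
  by (simp add: module_category_Hom free_module_def)

lemma free_id_module_hom:
  assumes "X \<in> Obj C"
  shows "Id C (MapO T X) \<in> Hom (module_category C T) (free_module T X) (free_module T X)"
  using MapM_module_hom[OF Id_Hom[OF assms]] MapM_Id[OF assms] by simp

lemma Mult_module_hom:
  assumes "X \<in> Obj C"
  shows "Mult T X \<in> Hom (module_category C T) (free_module T (MapO T X)) (free_module T X)"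
  using action_module_hom free_module_in_modules[OF assms] by (simp add: free_module_def)

text \<open>The bimonad axiom \<open>Comult_Mult\<close> is precisely the linearity required
  here.\<close>

lemma Comult_module_hom:
  assumes "X \<in> Obj C" "Y \<in> Obj C"
  shows "Comult T X Y \<in> Hom (module_category C T) (free_module T (X \<odot> Y))
    (TensorO (module_category C T) (free_module T X) (free_module T Y))"
  using assms free_module_in_modules Comult_Hom Comult_Mult tensor_module TensorO_Obj
  by (simp add: module_category_Hom free_module_def)

text \<open>The forgetful functor reflects isomorphisms: inserting \<open>T(f) T(g) = id\<close>
  after \<open>s\<close> lets linearity of \<open>f\<close> move the action across, and
  \<open>g f = id\<close> cancels the rest. It is needed because a star-inverse only produces an
  inverse in \<open>C\<close>, whereas a braiding asks for one in the module category.\<close>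

lemma module_hom_inverse:
  assumes f: "f \<in> Hom (module_category C T) (M, r) (N, s)"
    and g: "g \<in> Hom C N M" and gf: "g \<cdot> f = Id C M" and fg: "f \<cdot> g = Id C N"
  shows "g \<in> Hom (module_category C T) (N, s) (M, r)"
proof -
  have f': "f \<in> Hom C M N" "(M, r) \<in> modules C T" "(N, s) \<in> modules C T" "f \<cdot> r = s \<cdot> MapM T f"
    using f by (simp_all add: module_category_Hom)
  note M = modulesD[OF f'(2)] and N = modulesD[OF f'(3)]
  note Tf = MapM_Hom[OF f'(1)] and Tg = MapM_Hom[OF g]
  have "g \<cdot> s = g \<cdot> (s \<cdot> (MapM T f \<cdot> MapM T g))"
    using MapM_Comp[OF g f'(1)] fg MapM_Id N Comp_Id[OF N(2)] by simp
  also have "\<dots> = g \<cdot> ((f \<cdot> r) \<cdot> MapM T g)"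
    using Comp_assoc[OF Tg Tf N(2)] f' by simp
  also have "\<dots> = r \<cdot> MapM T g"
    using Comp_assoc[OF Tg M(2) f'(1)] Comp_assoc[OF Comp_Hom[OF Tg M(2)] f'(1) g] gf
      Id_Comp[OF Comp_Hom[OF Tg M(2)]] by simp
  finally show ?thesis using f' g by (simp add: module_category_Hom)
qed

end

section \<open>From an R-matrix to a braiding\<close>

context R_matrix begin

lemma R_Hom: "\<lbrakk>X \<in> Obj C; Y \<in> Obj C\<rbrakk> \<Longrightarrow> R X Y \<in> Hom C (X \<odot> Y) (MapO T Y \<odot> MapO T X)"
  by (rule PiE_mem[OF PiE_mem[OF family]])

lemma braiding_of_apply:
  "\<lbrakk>(M, r) \<in> modules C T; (N, s) \<in> modules C T\<rbrakk>
    \<Longrightarrow> braiding_of C T R (M, r) (N, s) = (s \<otimes> r) \<cdot> R M N"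
  by (simp add: braiding_of_def)

lemma braiding_of_Hom:
  assumes "(M, r) \<in> modules C T" "(N, s) \<in> modules C T"
  shows "(s \<otimes> r) \<cdot> R M N \<in> Hom C (M \<odot> N) (N \<odot> M)"
  using modulesD[OF assms(1)] modulesD[OF assms(2)] by (meson Comp_Hom R_Hom TensorM_Hom)

text \<open>The computation behind all properties of the braiding: naturality of R carries
  \<open>f \<otimes> g\<close> to the other side, and interchange merges it with the actions. Taking
  actions for \<open>f\<close> and \<open>g\<close> serves linearity and invertibility, an action
  and an identity the hexagons, module morphisms naturality, and units the recovery of R.\<close>

lemma braiding_of_action:
  assumes m: "(M, r) \<in> modules C T" and n: "(N, s) \<in> modules C T"
    and f: "f \<in> Hom C X M" and g: "g \<in> Hom C Y N"
  shows "((s \<otimes> r) \<cdot> R M N) \<cdot> (f \<otimes> g) = ((s \<cdot> MapM T g) \<otimes> (r \<cdot> MapM T f)) \<cdot> R X Y"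
proof -
  note M = modulesD[OF m] and N = modulesD[OF n]
  have X: "X \<in> Obj C" "Y \<in> Obj C" using Hom_Obj f g by auto
  have "((s \<otimes> r) \<cdot> R M N) \<cdot> (f \<otimes> g) = (s \<otimes> r) \<cdot> ((MapM T g \<otimes> MapM T f) \<cdot> R X Y)"
    using Comp_assoc[OF TensorM_Hom[OF f g] R_Hom[OF M(1) N(1)] TensorM_Hom[OF N(2) M(2)]]
      natural[OF f g] by simp
  then show ?thesis
    using tensor_comp_comp[OF R_Hom[OF X] MapM_Hom[OF g] N(2) MapM_Hom[OF f] M(2)] by simp
qed

text \<open>Both sides of the linearity equation are brought to the form
  \<open>s \<otimes> r\<close> after one side of \<open>R_Comult\<close>.\<close>

lemma braiding_of_module_hom:
  assumes m: "(M, r) \<in> modules C T" and n: "(N, s) \<in> modules C T"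
  shows "(s \<otimes> r) \<cdot> R M N \<in> Hom (module_category C T)
    (M \<odot> N, (r \<otimes> s) \<cdot> Comult T M N) (N \<odot> M, (s \<otimes> r) \<cdot> Comult T N M)"
proof -
  note M = modulesD[OF m] and N = modulesD[OF n]
  let ?T = "MapO T" and ?F = "MapM T" and ?D = "Comult T" and ?m = "Mult T"
  note o = MapO_Obj[OF M(1)] MapO_Obj[OF N(1)]
  note D = Comult_Hom[OF M(1) N(1)] and D' = Comult_Hom[OF N(1) M(1)]
  note DT = Comult_Hom[OF o(2,1)]
  note mu = TensorM_Hom[OF Mult_Hom[OF N(1)] Mult_Hom[OF M(1)]]
  note sr = TensorM_Hom[OF N(2) M(2)] and R = R_Hom[OF M(1) N(1)] and RT = R_Hom[OF o]
  note TR = MapM_Hom[OF R] and Tsr = MapM_Hom[OF sr]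
  note FF = TensorM_Hom[OF MapM_Hom[OF N(2)] MapM_Hom[OF M(2)]]
  have "((s \<otimes> r) \<cdot> R M N) \<cdot> ((r \<otimes> s) \<cdot> ?D M N)
      = (((s \<cdot> ?m N) \<otimes> (r \<cdot> ?m M)) \<cdot> R (?T M) (?T N)) \<cdot> ?D M N"
    using braiding_of_action[OF m n M(2) N(2)] M N
      Comp_assoc[OF D TensorM_Hom[OF M(2) N(2)] Comp_Hom[OF R sr]] by simp
  also have "\<dots> = (s \<otimes> r) \<cdot> ((?m N \<otimes> ?m M) \<cdot> R (?T M) (?T N) \<cdot> ?D M N)"
    using tensor_comp_comp[OF RT Mult_Hom[OF N(1)] N(2) Mult_Hom[OF M(1)] M(2)]
      Comp_assoc[OF D Comp_Hom[OF RT mu] sr] by simp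
  also have "\<dots> = (s \<otimes> r) \<cdot> ((?m N \<otimes> ?m M) \<cdot> (?D (?T N) (?T M) \<cdot> ?F (R M N)))"
    using R_Comult[OF M(1) N(1)] Comp_assoc[OF TR DT mu] by simp
  \<comment> \<open>Here \<open>s \<mu> = s T(s)\<close> and \<open>r \<mu> = r T(r)\<close> trade
    the multiplications for \<open>T(s) \<otimes> T(r)\<close>, which naturality of the
    comultiplication can then move past it.\<close>
  also have "\<dots> = (s \<otimes> r) \<cdot> ((?F s \<otimes> ?F r) \<cdot> (?D (?T N) (?T M) \<cdot> ?F (R M N)))"
    using tensor_comp_comp[OF Comp_Hom[OF TR DT] Mult_Hom[OF N(1)] N(2) Mult_Hom[OF M(1)] M(2)]
      tensor_comp_comp[OF Comp_Hom[OF TR DT] MapM_Hom[OF N(2)] N(2) MapM_Hom[OF M(2)] M(2)] M N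
    by simp
  also have "\<dots> = (s \<otimes> r) \<cdot> ((?D N M \<cdot> ?F (s \<otimes> r)) \<cdot> ?F (R M N))"
    using Comult_natural[OF N(2) M(2)] Comp_assoc[OF TR DT FF] by simp
  also have "\<dots> = ((s \<otimes> r) \<cdot> ?D N M) \<cdot> ?F ((s \<otimes> r) \<cdot> R M N)"
    using MapM_Comp[OF R sr] Comp_assoc[OF TR Tsr D'] Comp_assoc[OF Comp_Hom[OF TR Tsr] D' sr] by simp
  finally show ?thesis
    using braiding_of_Hom[OF m n] tensor_module[OF m n] tensor_module[OF n m]
    by (simp add: module_category_Hom)
qed

text \<open>The inverse has the same shape, with the star-inverse in place of R. Naturality against
  the actions and the module laws make a multiplication appear on each factor, star-invertibility
  reduces the composite to \<open>\<eta> \<otimes> \<eta>\<close>, and the unit laws of the two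
  modules finish.\<close>

lemma braiding_of_iso:
  assumes m: "(M, r) \<in> modules C T" and n: "(N, s) \<in> modules C T"
  shows "\<exists>g. g \<in> Hom C (N \<odot> M) (M \<odot> N) \<and> g \<cdot> ((s \<otimes> r) \<cdot> R M N) = Id C (M \<odot> N)
    \<and> ((s \<otimes> r) \<cdot> R M N) \<cdot> g = Id C (N \<odot> M)"
proof -
  note M = modulesD[OF m] and N = modulesD[OF n]
  obtain R' where R'_Hom: "\<forall>X\<in>Obj C. \<forall>Y\<in>Obj C. R' X Y \<in> Hom C (Y \<odot> X) (MapO T X \<odot> MapO T Y)"
    and R'_nat: "\<forall>X X' Y Y'. \<forall>f\<in>Hom C X X'. \<forall>g\<in>Hom C Y Y'.
      (MapM T f \<otimes> MapM T g) \<cdot> R' X Y = R' X' Y' \<cdot> (g \<otimes> f)"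
    and R'_inv: "\<forall>X\<in>Obj C. \<forall>Y\<in>Obj C.
      (Mult T X \<otimes> Mult T Y) \<cdot> R' (MapO T X) (MapO T Y) \<cdot> R X Y = Eta T X \<otimes> Eta T Y \<and>
      (Mult T Y \<otimes> Mult T X) \<cdot> R (MapO T X) (MapO T Y) \<cdot> R' X Y = Eta T Y \<otimes> Eta T X"
    using star_invertible by (elim exE conjE) (rule that)
  note o = MapO_Obj[OF M(1)] MapO_Obj[OF N(1)]
  note rs = TensorM_Hom[OF M(2) N(2)] and sr = TensorM_Hom[OF N(2) M(2)]
  note R = R_Hom[OF M(1) N(1)] and R' = R'_Hom[rule_format, OF M(1) N(1)]
  note RT = R_Hom[OF o] and RT' = R'_Hom[rule_format, OF o]
  note mu = TensorM_Hom[OF Mult_Hom[OF N(1)] Mult_Hom[OF M(1)]]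
  note mu' = TensorM_Hom[OF Mult_Hom[OF M(1)] Mult_Hom[OF N(1)]]
  let ?g = "(r \<otimes> s) \<cdot> R' M N"
  have g: "?g \<in> Hom C (N \<odot> M) (M \<odot> N)" using Comp_Hom[OF R' rs] .
  have "?g \<cdot> ((s \<otimes> r) \<cdot> R M N) = (r \<otimes> s) \<cdot> (((MapM T r \<otimes> MapM T s) \<cdot> R' (MapO T M) (MapO T N)) \<cdot> R M N)"
    using R'_nat[rule_format, OF M(2) N(2)] Comp_assoc[OF R sr R'] Comp_assoc[OF Comp_Hom[OF R sr] R' rs] by simp
  also have "\<dots> = (((r \<cdot> Mult T M) \<otimes> (s \<cdot> Mult T N)) \<cdot> R' (MapO T M) (MapO T N)) \<cdot> R M N"
    using tensor_comp_comp[OF Comp_Hom[OF R RT'] MapM_Hom[OF M(2)] M(2) MapM_Hom[OF N(2)] N(2)] M N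
      Comp_assoc[OF R RT' TensorM_Hom[OF MapM_Hom[OF M(2)] MapM_Hom[OF N(2)]]]
      Comp_assoc[OF R RT' TensorM_Hom[OF Comp_Hom[OF Mult_Hom[OF M(1)] M(2)] Comp_Hom[OF Mult_Hom[OF N(1)] N(2)]]]
    by simp
  also have "\<dots> = (r \<otimes> s) \<cdot> (Eta T M \<otimes> Eta T N)"
    using tensor_comp_comp[OF RT' Mult_Hom[OF M(1)] M(2) Mult_Hom[OF N(1)] N(2)]
      Comp_assoc[OF R Comp_Hom[OF RT' mu'] rs] R'_inv M N by simp
  also have "\<dots> = Id C (M \<odot> N)"
    using TensorM_Comp[OF Eta_Hom[OF M(1)] M(2) Eta_Hom[OF N(1)] N(2)] M N TensorM_Id by simp
  finally have 1: "?g \<cdot> ((s \<otimes> r) \<cdot> R M N) = Id C (M \<odot> N)" .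
  have "((s \<otimes> r) \<cdot> R M N) \<cdot> ?g = ((((s \<cdot> Mult T N) \<otimes> (r \<cdot> Mult T M))) \<cdot> R (MapO T M) (MapO T N)) \<cdot> R' M N"
    using braiding_of_action[OF m n M(2) N(2)] M N
      Comp_assoc[OF R' rs Comp_Hom[OF R sr]] by simp
  also have "\<dots> = (s \<otimes> r) \<cdot> (Eta T N \<otimes> Eta T M)"
    using tensor_comp_comp[OF RT Mult_Hom[OF N(1)] N(2) Mult_Hom[OF M(1)] M(2)]
      Comp_assoc[OF R' Comp_Hom[OF RT mu] sr] R'_inv M N by simp
  also have "\<dots> = Id C (N \<odot> M)"
    using TensorM_Comp[OF Eta_Hom[OF N(1)] N(2) Eta_Hom[OF M(1)] M(2)] M N TensorM_Id by simp
  finally show ?thesis using 1 g by blast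
qed

text \<open>The action on the tensor product \<open>N \<otimes> P\<close> contains the
  comultiplication, so \<open>R_tensor_right\<close> applies directly. What remains is to distribute
  the three actions over the two values of R that it produces.\<close>

lemma braiding_of_hexagon_right:
  assumes m: "(M, r) \<in> modules C T" and n: "(N, s) \<in> modules C T" and p: "(P, t) \<in> modules C T"
  shows "(((s \<otimes> t) \<cdot> Comult T N P) \<otimes> r) \<cdot> R M (N \<odot> P)
    = (Id C N \<otimes> ((t \<otimes> r) \<cdot> R M P)) \<cdot> (((s \<otimes> r) \<cdot> R M N) \<otimes> Id C P)"
proof -
  note M = modulesD[OF m] and N = modulesD[OF n] and P = modulesD[OF p]
  let ?T = "MapO T" and ?m = "Mult T"
  note o = MapO_Obj[OF M(1)] MapO_Obj[OF N(1)] MapO_Obj[OF P(1)]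
  note I = Id_Hom[OF o(1)] Id_Hom[OF o(2)] Id_Hom[OF o(3)]
  note D = Comult_Hom[OF N(1) P(1)] and mu = Mult_Hom[OF M(1)]
  note st = TensorM_Hom[OF N(2) P(2)] and tr = TensorM_Hom[OF P(2) M(2)] and sr = TensorM_Hom[OF N(2) M(2)]
  note RMN = R_Hom[OF M(1) N(1)] and RT = R_Hom[OF o(1) P(1)]
  note tau = braiding_of_Hom[OF m p]
  note rP = TensorM_Hom[OF M(2) Id_Hom[OF P(1)]]
  have A: "R M N \<otimes> Id C P \<in> Hom C (M \<odot> N \<odot> P) (?T N \<odot> ?T M \<odot> P)"
    using TensorM_Hom[OF RMN Id_Hom[OF P(1)]] TensorO_assoc M N P o by simp
  \<comment> \<open>Splitting the identity leaves the multiplication on the last two factors, where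
    it meets \<open>R (?T M) P\<close>.\<close>
  have E: "Id C (?T N \<odot> ?T P) \<otimes> ?m M = Id C (?T N) \<otimes> (Id C (?T P) \<otimes> ?m M)"
    using TensorM_assoc[OF I(2,3) mu] TensorM_Id o by simp
  note Im = TensorM_Hom[OF I(3) mu]
  have RNP: "R M (N \<odot> P) \<in> Hom C (M \<odot> N \<odot> P) (?T (N \<odot> P) \<odot> ?T M)"
    using R_Hom[OF M(1) TensorO_Obj[OF N(1) P(1)]] .
  \<comment> \<open>The multiplication on \<open>T M\<close> lets the action \<open>r\<close> be
    pulled through R: it reappears in front of the braiding of \<open>M\<close> and
    \<open>P\<close>, exactly where the braiding of \<open>M\<close> and \<open>N\<close> still
    lacks its action on \<open>M\<close>.\<close>
  have L: "(t \<otimes> r) \<cdot> ((Id C (?T P) \<otimes> ?m M) \<cdot> R (?T M) P) = ((t \<otimes> r) \<cdot> R M P) \<cdot> (r \<otimes> Id C P)"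
    using braiding_of_action[OF m p M(2) Id_Hom[OF P(1)]] MapM_Id P M
      tensor_comp_comp[OF RT I(3) P(2) mu M(2)] by simp
  have "(((s \<otimes> t) \<cdot> Comult T N P) \<otimes> r) \<cdot> R M (N \<odot> P)
      = ((s \<otimes> t) \<otimes> r) \<cdot> ((Comult T N P \<otimes> Id C (?T M)) \<cdot> R M (N \<odot> P))"
    using tensor_comp_left(1)[OF D st M(2)]
      Comp_assoc[OF RNP TensorM_Hom[OF D I(1)] TensorM_Hom[OF st M(2)]] by simp
  also have "\<dots> = (s \<otimes> (t \<otimes> r)) \<cdot> (((Id C (?T N) \<otimes> (Id C (?T P) \<otimes> ?m M)) \<cdot> (Id C (?T N) \<otimes> R (?T M) P))
      \<cdot> (R M N \<otimes> Id C P))"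
    using R_tensor_right[OF M(1) N(1) P(1)] TensorM_assoc[OF N(2) P(2) M(2)] E by simp
  also have "\<dots> = ((s \<otimes> (t \<otimes> r)) \<cdot> (Id C (?T N) \<otimes> ((Id C (?T P) \<otimes> ?m M) \<cdot> R (?T M) P)))
      \<cdot> (R M N \<otimes> Id C P)"
    using tensor_comp_right(1)[OF RT Im I(2)]
      Comp_assoc[OF A TensorM_Hom[OF I(2) Comp_Hom[OF RT Im]] TensorM_Hom[OF N(2) tr]] by simp
  also have "\<dots> = (s \<otimes> (((t \<otimes> r) \<cdot> R M P) \<cdot> (r \<otimes> Id C P))) \<cdot> (R M N \<otimes> Id C P)"
    using tensor_comp_right(1)[OF Comp_Hom[OF RT Im] tr N(2)] L by simp
  also have "\<dots> = (Id C N \<otimes> ((t \<otimes> r) \<cdot> R M P)) \<cdot> (((s \<otimes> r) \<otimes> Id C P) \<cdot> (R M N \<otimes> Id C P))"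
    using tensor_comp_right(2)[OF rP tau N(2)]
      Comp_assoc[OF A TensorM_Hom[OF N(2) rP] TensorM_Hom[OF Id_Hom[OF N(1)] tau]]
      TensorM_assoc[OF N(2) M(2) Id_Hom[OF P(1)]] by simp
  also have "\<dots> = (Id C N \<otimes> ((t \<otimes> r) \<cdot> R M P)) \<cdot> (((s \<otimes> r) \<cdot> R M N) \<otimes> Id C P)"
    using tensor_comp_left(1)[OF RMN sr Id_Hom[OF P(1)]] by simp
  finally show ?thesis .
qed

text \<open>Mirror image of the other hexagon: the multiplication now sits on \<open>T P\<close>, so
  it is the action \<open>t\<close> that is pulled through R and completes the braiding of
  \<open>N\<close> and \<open>P\<close>.\<close>

lemma braiding_of_hexagon_left:
  assumes m: "(M, r) \<in> modules C T" and n: "(N, s) \<in> modules C T" and p: "(P, t) \<in> modules C T"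
  shows "(t \<otimes> ((r \<otimes> s) \<cdot> Comult T M N)) \<cdot> R (M \<odot> N) P
    = (((t \<otimes> r) \<cdot> R M P) \<otimes> Id C N) \<cdot> (Id C M \<otimes> ((t \<otimes> s) \<cdot> R N P))"
proof -
  note M = modulesD[OF m] and N = modulesD[OF n] and P = modulesD[OF p]
  let ?T = "MapO T" and ?m = "Mult T"
  note o = MapO_Obj[OF M(1)] MapO_Obj[OF N(1)] MapO_Obj[OF P(1)]
  note I = Id_Hom[OF o(1)] Id_Hom[OF o(2)] Id_Hom[OF o(3)]
  note D = Comult_Hom[OF M(1) N(1)] and mu = Mult_Hom[OF P(1)]
  note rs = TensorM_Hom[OF M(2) N(2)] and tr = TensorM_Hom[OF P(2) M(2)] and ts = TensorM_Hom[OF P(2) N(2)]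
  note RNP = R_Hom[OF N(1) P(1)] and RT = R_Hom[OF M(1) o(3)]
  note tau = braiding_of_Hom[OF m p]
  note Mt = TensorM_Hom[OF Id_Hom[OF M(1)] P(2)]
  have A: "Id C M \<otimes> R N P \<in> Hom C (M \<odot> N \<odot> P) ((M \<odot> ?T P) \<odot> ?T N)"
    using TensorM_Hom[OF Id_Hom[OF M(1)] RNP] TensorO_assoc M N P o by simp
  have E: "?m P \<otimes> Id C (?T M \<odot> ?T N) = (?m P \<otimes> Id C (?T M)) \<otimes> Id C (?T N)"
    using TensorM_assoc[OF mu I(1,2)] TensorM_Id o by simp
  note Im = TensorM_Hom[OF mu I(1)]
  have RMNP: "R (M \<odot> N) P \<in> Hom C (M \<odot> N \<odot> P) (?T P \<odot> ?T (M \<odot> N))"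
    using R_Hom[OF TensorO_Obj[OF M(1) N(1)] P(1)] TensorO_assoc M N P by simp
  have L: "(t \<otimes> r) \<cdot> ((?m P \<otimes> Id C (?T M)) \<cdot> R M (?T P)) = ((t \<otimes> r) \<cdot> R M P) \<cdot> (Id C M \<otimes> t)"
    using braiding_of_action[OF m p Id_Hom[OF M(1)] P(2)] MapM_Id P M
      tensor_comp_comp[OF RT mu P(2) I(1) M(2)] by simp
  have "(t \<otimes> ((r \<otimes> s) \<cdot> Comult T M N)) \<cdot> R (M \<odot> N) P
      = (t \<otimes> (r \<otimes> s)) \<cdot> ((Id C (?T P) \<otimes> Comult T M N) \<cdot> R (M \<odot> N) P)"
    using tensor_comp_right(1)[OF D rs P(2)]
      Comp_assoc[OF RMNP TensorM_Hom[OF I(3) D] TensorM_Hom[OF P(2) rs]] by simp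
  also have "\<dots> = ((t \<otimes> r) \<otimes> s) \<cdot> ((((?m P \<otimes> Id C (?T M)) \<otimes> Id C (?T N)) \<cdot> (R M (?T P) \<otimes> Id C (?T N)))
      \<cdot> (Id C M \<otimes> R N P))"
    using R_tensor_left[OF M(1) N(1) P(1)] TensorM_assoc[OF P(2) M(2) N(2)] E by simp
  also have "\<dots> = (((t \<otimes> r) \<otimes> s) \<cdot> (((?m P \<otimes> Id C (?T M)) \<cdot> R M (?T P)) \<otimes> Id C (?T N)))
      \<cdot> (Id C M \<otimes> R N P)"
    using tensor_comp_left(1)[OF RT Im I(2)]
      Comp_assoc[OF A TensorM_Hom[OF Comp_Hom[OF RT Im] I(2)] TensorM_Hom[OF tr N(2)]] by simp
  also have "\<dots> = ((((t \<otimes> r) \<cdot> R M P) \<cdot> (Id C M \<otimes> t)) \<otimes> s) \<cdot> (Id C M \<otimes> R N P)"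
    using tensor_comp_left(1)[OF Comp_Hom[OF RT Im] tr N(2)] L by simp
  also have "\<dots> = (((t \<otimes> r) \<cdot> R M P) \<otimes> Id C N) \<cdot> ((Id C M \<otimes> (t \<otimes> s)) \<cdot> (Id C M \<otimes> R N P))"
    using tensor_comp_left(2)[OF Mt tau N(2)]
      Comp_assoc[OF A TensorM_Hom[OF Mt N(2)] TensorM_Hom[OF tau Id_Hom[OF N(1)]]]
      TensorM_assoc[OF Id_Hom[OF M(1)] P(2) N(2)] by simp
  also have "\<dots> = (((t \<otimes> r) \<cdot> R M P) \<otimes> Id C N) \<cdot> (Id C M \<otimes> ((t \<otimes> s) \<cdot> R N P))"
    using tensor_comp_right(1)[OF RNP ts Id_Hom[OF M(1)]] by simp
  finally show ?thesis .
qed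

lemma braiding_braiding_of: "braiding (module_category C T) (braiding_of C T R)"
proof -
  interpret mod: strict_monoidal_category "module_category C T" by (rule strict_monoidal_modules)
  show ?thesis
  proof (unfold_locales, goal_cases)
    case 1
    show ?case
      using braiding_of_module_hom by (auto simp: braiding_of_def)
  next
    case (2 f X X' g Y Y')
    obtain M r M' r' N s N' s' where e: "X = (M, r)" "X' = (M', r')" "Y = (N, s)" "Y' = (N', s')"
      by (metis surj_pair)
    have f: "f \<in> Hom C M M'" "(M, r) \<in> modules C T" "(M', r') \<in> modules C T" "f \<cdot> r = r' \<cdot> MapM T f"
      and g: "g \<in> Hom C N N'" "(N, s) \<in> modules C T" "(N', s') \<in> modules C T" "g \<cdot> s = s' \<cdot> MapM T g"
      using 2 e by (simp_all add: module_category_Hom)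
    note M = modulesD[OF f(2)] and N = modulesD[OF g(2)]
    show ?case
      using braiding_of_action[OF f(3) g(3) f(1) g(1)] e f g
        tensor_comp_comp[OF R_Hom[OF M(1) N(1)] N(2) g(1) M(2) f(1)]
      by (simp add: braiding_of_apply)
  next
    case (3 X Y)
    obtain M r N s where e: "X = (M, r)" "Y = (N, s)" by (metis surj_pair)
    have m: "(M, r) \<in> modules C T" "(N, s) \<in> modules C T" using 3 e by simp_all
    obtain g where g: "g \<in> Hom C (N \<odot> M) (M \<odot> N)" "g \<cdot> ((s \<otimes> r) \<cdot> R M N) = Id C (M \<odot> N)"
      "((s \<otimes> r) \<cdot> R M N) \<cdot> g = Id C (N \<odot> M)"
      using braiding_of_iso[OF m] by blast
    show ?case
      unfolding iso_def using module_hom_inverse[OF braiding_of_module_hom[OF m] g] g m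
        braiding_of_module_hom[OF m] e
      by (auto simp: braiding_of_apply)
  next
    case (4 X Y Z)
    obtain M r N s P t where e: "X = (M, r)" "Y = (N, s)" "Z = (P, t)" by (metis surj_pair)
    then show ?case using 4 tensor_module braiding_of_hexagon_right by (simp add: braiding_of_apply)
  next
    case (5 X Y Z)
    obtain M r N s P t where e: "X = (M, r)" "Y = (N, s)" "Z = (P, t)" by (metis surj_pair)
    then show ?case using 5 tensor_module braiding_of_hexagon_left by (simp add: braiding_of_apply)
  qed
qed

end

section \<open>From a natural swap of modules to a family on the base category\<close>

text \<open>Restricting both arguments to objects gives the result the default value elsewhere, so
  the two assignments can be inverse as functions and not only on objects.\<close>

definition R_matrix_of ::
  "('o, 'm, 'y) monoidal_data_scheme \<Rightarrow> ('o, 'm, 'z) bimonad_data_scheme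
    \<Rightarrow> ('o \<times> 'm \<Rightarrow> 'o \<times> 'm \<Rightarrow> 'm) \<Rightarrow> 'o \<Rightarrow> 'o \<Rightarrow> 'm" where
  "R_matrix_of C T \<tau> = (\<lambda>X\<in>Obj C. \<lambda>Y\<in>Obj C.
     \<tau> (free_module T X) (free_module T Y) \<cdot>\<^bsub>C\<^esub> (Eta T X \<otimes>\<^bsub>C\<^esub> Eta T Y))"

text \<open>Pulling the two units through R leaves \<open>\<mu> T(\<eta>) = id\<close> on each
  factor; outside the objects both families take the default value.\<close>

lemma (in R_matrix) R_matrix_of_braiding_of: "R_matrix_of C T (braiding_of C T R) = R"
proof -
  have "R_matrix_of C T (braiding_of C T R) X Y = R X Y" if X: "X \<in> Obj C" "Y \<in> Obj C" for X Y
  proof -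
    note F = free_module_in_modules[OF X(1), unfolded free_module_def]
      free_module_in_modules[OF X(2), unfolded free_module_def]
    have o: "MapO T X \<in> Obj C" "MapO T Y \<in> Obj C" using X MapO_Obj by auto
    show ?thesis
      using braiding_of_action[OF F Eta_Hom[OF X(1)] Eta_Hom[OF X(2)]] X F
        Mult_Eta_right TensorM_Id o Id_Comp[OF R_Hom[OF X]]
      by (simp add: R_matrix_of_def free_module_def braiding_of_apply)
  qed
  moreover have "R \<in> extensional (Obj C)" "\<And>X. X \<in> Obj C \<Longrightarrow> R X \<in> extensional (Obj C)"
    using family by (auto simp: PiE_def)
  moreover have "R_matrix_of C T \<tau> \<in> extensional (Obj C)"
    "\<And>X. X \<in> Obj C \<Longrightarrow> R_matrix_of C T \<tau> X \<in> extensional (Obj C)" for \<tau>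
    by (simp_all add: R_matrix_of_def)
  ultimately show ?thesis
    by (intro extensionalityI[where A = "Obj C"])
qed

text \<open>Besides the braiding itself this covers its inverse, from which the star-inverse of the
  R-matrix is built.\<close>

locale natural_swap = bimonad C T for C (structure) and T +
  fixes \<tau> :: "'a \<times> 'b \<Rightarrow> 'a \<times> 'b \<Rightarrow> 'b"
  assumes swap_Hom: "\<lbrakk>(M, r) \<in> modules C T; (N, s) \<in> modules C T\<rbrakk>
      \<Longrightarrow> \<tau> (M, r) (N, s) \<in> Hom C (M \<odot> N) (N \<odot> M)"
    and swap_natural: "\<lbrakk>f \<in> Hom (module_category C T) A A'; g \<in> Hom (module_category C T) B B'\<rbrakk>
      \<Longrightarrow> (g \<otimes> f) \<cdot> \<tau> A B = \<tau> A' B' \<cdot> (f \<otimes> g)"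
begin

lemma R_matrix_of_apply: "\<lbrakk>X \<in> Obj C; Y \<in> Obj C\<rbrakk>
  \<Longrightarrow> R_matrix_of C T \<tau> X Y = \<tau> (free_module T X) (free_module T Y) \<cdot> (Eta T X \<otimes> Eta T Y)"
  by (simp add: R_matrix_of_def)

lemma swap_free_Hom: "\<lbrakk>X \<in> Obj C; Y \<in> Obj C\<rbrakk>
  \<Longrightarrow> \<tau> (free_module T X) (free_module T Y) \<in> Hom C (MapO T X \<odot> MapO T Y) (MapO T Y \<odot> MapO T X)"
  using swap_Hom free_module_in_modules by (simp add: free_module_def)

lemma R_matrix_of_Hom: "\<lbrakk>X \<in> Obj C; Y \<in> Obj C\<rbrakk> \<Longrightarrow> R_matrix_of C T \<tau> X Y \<in> Hom C (X \<odot> Y) (MapO T Y \<odot> MapO T X)"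
  unfolding R_matrix_of_apply by (meson Comp_Hom Eta_Hom TensorM_Hom swap_free_Hom)

text \<open>A module morphism out of a free module enters only through its restriction along the
  unit. Every later identity is an instance or a consequence of this one, the morphisms being
  actions, multiplications, maps \<open>T(f)\<close>, identities or the comultiplication.\<close>

lemma R_matrix_of_hom_natural:
  assumes "f \<in> Hom (module_category C T) (free_module T X) (M, r)"
    and "g \<in> Hom (module_category C T) (free_module T Y) (N, s)"
    and X: "X \<in> Obj C" "Y \<in> Obj C"
  shows "(g \<otimes> f) \<cdot> R_matrix_of C T \<tau> X Y = \<tau> (M, r) (N, s) \<cdot> ((f \<cdot> Eta T X) \<otimes> (g \<cdot> Eta T Y))"
proof -
  have f: "f \<in> Hom C (MapO T X) M" "(M, r) \<in> modules C T"
    and g: "g \<in> Hom C (MapO T Y) N" "(N, s) \<in> modules C T"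
    using assms by (auto simp: module_category_Hom free_module_def)
  note e = Eta_Hom[OF X(1)] Eta_Hom[OF X(2)]
  show ?thesis
    using Comp_assoc[OF TensorM_Hom[OF e] swap_free_Hom[OF X] TensorM_Hom[OF g(1) f(1)]]
      swap_natural[OF assms(1,2)] TensorM_Comp[OF e(1) f(1) e(2) g(1)]
      Comp_assoc[OF TensorM_Hom[OF e] TensorM_Hom[OF f(1) g(1)] swap_Hom[OF f(2) g(2)]] X
    by (simp add: R_matrix_of_apply)
qed

lemma R_matrix_of_action:
  assumes m: "(M, r) \<in> modules C T" and n: "(N, s) \<in> modules C T"
  shows "(s \<otimes> r) \<cdot> R_matrix_of C T \<tau> M N = \<tau> (M, r) (N, s)"
  using R_matrix_of_hom_natural[OF action_module_hom[OF m] action_module_hom[OF n]]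
    modulesD[OF m] modulesD[OF n] TensorM_Id Comp_Id[OF swap_Hom[OF m n]] by simp

text \<open>This removes the multiplications from the R-matrix axioms: a multiplied value of the
  family is a swap of free modules.\<close>

lemma R_matrix_of_Mult:
  assumes X: "X \<in> Obj C" "Y \<in> Obj C"
  shows "(Mult T Y \<otimes> Mult T X) \<cdot> R_matrix_of C T \<tau> (MapO T X) (MapO T Y) = \<tau> (free_module T X) (free_module T Y)"
  using R_matrix_of_action free_module_in_modules X by (simp add: free_module_def)

text \<open>Naturality over \<open>C\<close> descends from naturality over modules because
  \<open>T(f)\<close> is a morphism of free modules whose restriction along the unit is
  \<open>\<eta> f\<close>.\<close>

lemma R_matrix_of_natural:
  assumes f: "f \<in> Hom C X X'" and g: "g \<in> Hom C Y Y'"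
  shows "(MapM T g \<otimes> MapM T f) \<cdot> R_matrix_of C T \<tau> X Y = R_matrix_of C T \<tau> X' Y' \<cdot> (f \<otimes> g)"
proof -
  have o: "X \<in> Obj C" "X' \<in> Obj C" "Y \<in> Obj C" "Y' \<in> Obj C" using Hom_Obj f g by auto
  have "(MapM T g \<otimes> MapM T f) \<cdot> R_matrix_of C T \<tau> X Y
    = \<tau> (free_module T X') (free_module T Y') \<cdot> ((MapM T f \<cdot> Eta T X) \<otimes> (MapM T g \<cdot> Eta T Y))"
    using R_matrix_of_hom_natural MapM_module_hom[OF f] MapM_module_hom[OF g] o by (metis surj_pair)
  also have "\<dots> = R_matrix_of C T \<tau> X' Y' \<cdot> (f \<otimes> g)"
    using Eta_natural[OF f] Eta_natural[OF g] TensorM_Comp[OF f Eta_Hom g Eta_Hom] o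
      Comp_assoc[OF TensorM_Hom[OF f g] TensorM_Hom[OF Eta_Hom Eta_Hom] swap_free_Hom]
    by (simp add: R_matrix_of_apply)
  finally show ?thesis .
qed

end

section \<open>From a braiding to an R-matrix\<close>

locale module_braiding = braiding "module_category C T" \<tau> + bimonad C T
  for C (structure) and T and \<tau>
begin

sublocale natural_swap C T \<tau>
proof
  fix M r N s assume m: "(M, r) \<in> modules C T" "(N, s) \<in> modules C T"
  then have "\<tau> (M, r) (N, s) \<in> Hom (module_category C T)
     ((M, r) \<odot>\<^bsub>module_category C T\<^esub> (N, s)) ((N, s) \<odot>\<^bsub>module_category C T\<^esub> (M, r))"
    using braiding_Hom[of "(M, r)" "(N, s)"] by simp
  then show "\<tau> (M, r) (N, s) \<in> Hom C (M \<odot> N) (N \<odot> M)" by (simp add: module_category_Hom)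
next
  fix f A A' g B B'
  assume "f \<in> Hom (module_category C T) A A'" "g \<in> Hom (module_category C T) B B'"
  then show "(g \<otimes> f) \<cdot> \<tau> A B = \<tau> A' B' \<cdot> (f \<otimes> g)" using natural by simp
qed

text \<open>The arguments are ordered so that the inverse is again a swap, from the product of the
  first and second argument to the reversed product. It is chosen among morphisms of
  \<open>C\<close>, since restriction to free modules does not ask the components to be
  linear.\<close>

definition inv_swap where
  "inv_swap B A = (SOME g. g \<in> Hom C (fst B \<odot> fst A) (fst A \<odot> fst B)
     \<and> g \<cdot> \<tau> A B = Id C (fst A \<odot> fst B) \<and> \<tau> A B \<cdot> g = Id C (fst B \<odot> fst A))"

lemma inv_swap:
  assumes "(M, r) \<in> modules C T" "(N, s) \<in> modules C T"
  shows "inv_swap (N, s) (M, r) \<in> Hom C (N \<odot> M) (M \<odot> N)"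
    and "inv_swap (N, s) (M, r) \<cdot> \<tau> (M, r) (N, s) = Id C (M \<odot> N)"
    and "\<tau> (M, r) (N, s) \<cdot> inv_swap (N, s) (M, r) = Id C (N \<odot> M)"
proof -
  have "\<exists>g. g \<in> Hom C (N \<odot> M) (M \<odot> N) \<and> g \<cdot> \<tau> (M, r) (N, s) = Id C (M \<odot> N)
     \<and> \<tau> (M, r) (N, s) \<cdot> g = Id C (N \<odot> M)"
    using isomorphism[of "(M, r)" "(N, s)"] assms unfolding iso_def by (auto simp: module_category_Hom)
  from someI_ex[OF this]
  show "inv_swap (N, s) (M, r) \<in> Hom C (N \<odot> M) (M \<odot> N)"
    and "inv_swap (N, s) (M, r) \<cdot> \<tau> (M, r) (N, s) = Id C (M \<odot> N)"
    and "\<tau> (M, r) (N, s) \<cdot> inv_swap (N, s) (M, r) = Id C (N \<odot> M)"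
    unfolding inv_swap_def by simp_all
qed

sublocale inv: natural_swap C T inv_swap
proof
  fix M r N s assume m: "(M, r) \<in> modules C T" "(N, s) \<in> modules C T"
  show "inv_swap (M, r) (N, s) \<in> Hom C (M \<odot> N) (N \<odot> M)" by (rule inv_swap(1)[OF m(2,1)])
next
  fix f A A' g B B'
  assume f': "f \<in> Hom (module_category C T) A A'" and g': "g \<in> Hom (module_category C T) B B'"
  obtain M r M' r' N s N' s' where e: "A = (M, r)" "A' = (M', r')" "B = (N, s)" "B' = (N', s')"
    by (metis surj_pair)
  have f: "f \<in> Hom C M M'" "(M, r) \<in> modules C T" "(M', r') \<in> modules C T"
    and g: "g \<in> Hom C N N'" "(N, s) \<in> modules C T" "(N', s') \<in> modules C T"
    using f' g' e by (simp_all add: module_category_Hom)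
  note i = inv_swap[OF g(2) f(2)] and i' = inv_swap[OF g(3) f(3)]
  note t = swap_Hom[OF g(2) f(2)] and t' = swap_Hom[OF g(3) f(3)]
  note gf = TensorM_Hom[OF g(1) f(1)] and fg = TensorM_Hom[OF f(1) g(1)]
  \<comment> \<open>Naturality of an inverse: insert \<open>\<tau>^{-1} \<tau>\<close> on the left,
    use naturality of \<open>\<tau>\<close>, and cancel on the right.\<close>
  have "(g \<otimes> f) \<cdot> inv_swap (M, r) (N, s)
     = (inv_swap (M', r') (N', s') \<cdot> \<tau> (N', s') (M', r')) \<cdot> ((g \<otimes> f) \<cdot> inv_swap (M, r) (N, s))"
    using i'(2) Id_Comp[OF Comp_Hom[OF i(1) gf]] by simp
  also have "\<dots> = inv_swap (M', r') (N', s') \<cdot> ((\<tau> (N', s') (M', r') \<cdot> (g \<otimes> f)) \<cdot> inv_swap (M, r) (N, s))"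
    using Comp_assoc[OF Comp_Hom[OF i(1) gf] t' i'(1)] Comp_assoc[OF i(1) gf t'] by simp
  also have "\<tau> (N', s') (M', r') \<cdot> (g \<otimes> f) = (f \<otimes> g) \<cdot> \<tau> (N, s) (M, r)"
    using swap_natural[OF g' f'] e by simp
  also have "((f \<otimes> g) \<cdot> \<tau> (N, s) (M, r)) \<cdot> inv_swap (M, r) (N, s) = f \<otimes> g"
    using Comp_assoc[OF i(1) t fg] i(3) Comp_Id[OF fg] by simp
  finally show "(g \<otimes> f) \<cdot> inv_swap A B = inv_swap A' B' \<cdot> (f \<otimes> g)" using e by simp
qed

text \<open>\<open>R_matrix_of_Mult\<close> collapses the multiplied factor to a swap of free
  modules; it cancels against the swap in the other factor and leaves only the two units.\<close>

lemma inv_swap_cancel: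
  assumes X: "X \<in> Obj C" "Y \<in> Obj C"
  shows "(Mult T X \<otimes> Mult T Y) \<cdot> R_matrix_of C T inv_swap (MapO T Y) (MapO T X) \<cdot> R_matrix_of C T \<tau> X Y = Eta T X \<otimes> Eta T Y"
    and "(Mult T Y \<otimes> Mult T X) \<cdot> R_matrix_of C T \<tau> (MapO T X) (MapO T Y) \<cdot> R_matrix_of C T inv_swap Y X = Eta T Y \<otimes> Eta T X"
proof -
  note F = free_module_in_modules[OF X(1), unfolded free_module_def]
    free_module_in_modules[OF X(2), unfolded free_module_def]
  note i = inv_swap[OF F, folded free_module_def]
  note e = Eta_Hom[OF X(1)] Eta_Hom[OF X(2)]
  show "(Mult T X \<otimes> Mult T Y) \<cdot> R_matrix_of C T inv_swap (MapO T Y) (MapO T X) \<cdot> R_matrix_of C T \<tau> X Y = Eta T X \<otimes> Eta T Y"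
    using inv.R_matrix_of_Mult[OF X(2,1)] R_matrix_of_apply[OF X] i Id_Comp[OF TensorM_Hom[OF e]]
      Comp_assoc[OF TensorM_Hom[OF e] swap_free_Hom[OF X] i(1)] by simp
  show "(Mult T Y \<otimes> Mult T X) \<cdot> R_matrix_of C T \<tau> (MapO T X) (MapO T Y) \<cdot> R_matrix_of C T inv_swap Y X = Eta T Y \<otimes> Eta T X"
    using R_matrix_of_Mult[OF X] inv.R_matrix_of_apply[OF X(2,1)] i Id_Comp[OF TensorM_Hom[OF e(2,1)]]
      Comp_assoc[OF TensorM_Hom[OF e(2,1)] i(1) swap_free_Hom[OF X]] by simp
qed

text \<open>Both sides equal \<open>\<tau>_{F X, F Y}\<close> after the comultiplication. On the
  left this is \<open>R_matrix_of_Mult\<close>; on the right linearity of \<open>\<tau>\<close>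
  brings it to the front, and naturality of the comultiplication leaves
  \<open>\<mu> T(\<eta>) = id\<close>.\<close>

lemma R_matrix_of_Comult:
  assumes X: "X \<in> Obj C" "Y \<in> Obj C"
  shows "(Mult T Y \<otimes> Mult T X) \<cdot> R_matrix_of C T \<tau> (MapO T X) (MapO T Y) \<cdot> Comult T X Y
    = (Mult T Y \<otimes> Mult T X) \<cdot> Comult T (MapO T Y) (MapO T X) \<cdot> MapM T (R_matrix_of C T \<tau> X Y)"
proof -
  let ?t = "\<tau> (free_module T X) (free_module T Y)"
  note F = free_module_in_modules[OF X(1)] free_module_in_modules[OF X(2)]
  have o: "MapO T X \<in> Obj C" "MapO T Y \<in> Obj C" using X MapO_Obj by auto
  note e = Eta_Hom[OF X(1)] Eta_Hom[OF X(2)] and mu = Mult_Hom[OF X(1)] Mult_Hom[OF X(2)]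
  note t = swap_free_Hom[OF X] and ee = TensorM_Hom[OF e] and mm = TensorM_Hom[OF mu]
  note D = Comult_Hom[OF X] and DT = Comult_Hom[OF o] and DT' = Comult_Hom[OF o(2,1)]
  note mD = Comp_Hom[OF DT mm] and Tee = MapM_Hom[OF ee]
  have "?t \<in> Hom (module_category C T)
     (free_module T X \<odot>\<^bsub>module_category C T\<^esub> free_module T Y) (free_module T Y \<odot>\<^bsub>module_category C T\<^esub> free_module T X)"
    using braiding_Hom F by simp
  then have lin: "?t \<cdot> ((Mult T X \<otimes> Mult T Y) \<cdot> Comult T (MapO T X) (MapO T Y))
      = ((Mult T Y \<otimes> Mult T X) \<cdot> Comult T (MapO T Y) (MapO T X)) \<cdot> MapM T ?t"
    by (simp add: free_module_def module_category_Hom)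
  note mD' = Comp_Hom[OF DT' TensorM_Hom[OF mu(2,1)]]
  have "(Mult T Y \<otimes> Mult T X) \<cdot> Comult T (MapO T Y) (MapO T X) \<cdot> MapM T (R_matrix_of C T \<tau> X Y)
      = ?t \<cdot> (((Mult T X \<otimes> Mult T Y) \<cdot> Comult T (MapO T X) (MapO T Y)) \<cdot> MapM T (Eta T X \<otimes> Eta T Y))"
    using lin MapM_Comp[OF ee t] R_matrix_of_apply[OF X] Comp_assoc[OF Tee MapM_Hom[OF t] mD']
      Comp_assoc[OF Tee mD t] by simp
  also have "\<dots> = ?t \<cdot> ((Mult T X \<otimes> Mult T Y) \<cdot> ((MapM T (Eta T X) \<otimes> MapM T (Eta T Y)) \<cdot> Comult T X Y))"
    using Comp_assoc[OF Tee DT mm] Comult_natural[OF e] by simp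
  also have "\<dots> = ?t \<cdot> Comult T X Y"
    using tensor_comp_comp[OF D MapM_Hom[OF e(1)] mu(1) MapM_Hom[OF e(2)] mu(2)]
      Mult_Eta_right X TensorM_Id[OF o] Id_Comp[OF D] by simp
  finally show ?thesis using R_matrix_of_Mult[OF X] by simp
qed

text \<open>Both sides are the hexagon for three free modules restricted along three units.\<close>

lemma R_matrix_of_tensor_right:
  assumes X: "X \<in> Obj C" "Y \<in> Obj C" "Z \<in> Obj C"
  shows "(Comult T Y Z \<otimes> Id C (MapO T X)) \<cdot> R_matrix_of C T \<tau> X (Y \<odot> Z)
    = (Id C (MapO T Y \<odot> MapO T Z) \<otimes> Mult T X) \<cdot> (Id C (MapO T Y) \<otimes> R_matrix_of C T \<tau> (MapO T X) Z)
      \<cdot> (R_matrix_of C T \<tau> X Y \<otimes> Id C Z)"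
proof -
  let ?R = "R_matrix_of C T \<tau>" and ?F = "free_module T" and ?T = "MapO T" and ?D = "module_category C T"
  have o: "?T X \<in> Obj C" "?T Y \<in> Obj C" "?T Z \<in> Obj C" using X MapO_Obj by auto
  note I = Id_Hom[OF o(1)] Id_Hom[OF o(2)] Id_Hom[OF o(3)]
  note e = Eta_Hom[OF X(1)] Eta_Hom[OF X(2)] Eta_Hom[OF X(3)]
  note F = free_module_in_modules[OF X(1)] free_module_in_modules[OF X(2)] free_module_in_modules[OF X(3)]
  note tXY = swap_free_Hom[OF X(1,2)] and tXZ = swap_free_Hom[OF X(1,3)]
  note RXY = R_matrix_of_Hom[OF X(1,2)] and RT = R_matrix_of_Hom[OF o(1) X(3)] and mu = Mult_Hom[OF X(1)]
  \<comment> \<open>Naturality of \<open>\<tau>\<close> for the multiplication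
    \<open>F (T X) -> F X\<close> and an identity. The unit on \<open>T X\<close> is cancelled by
    the multiplication, while the unit on \<open>Z\<close> survives. The \<open>fst\<close> and
    \<open>snd\<close> present the free modules as explicit pairs.\<close>
  have K: "(Id C (?T Z) \<otimes> Mult T X) \<cdot> ?R (?T X) Z = \<tau> (?F X) (?F Z) \<cdot> (Id C (?T X) \<otimes> Eta T Z)"
    using R_matrix_of_hom_natural[of "Mult T X" "?T X" "fst (?F X)" "snd (?F X)" "Id C (?T Z)" Z "fst (?F Z)" "snd (?F Z)"]
      free_id_module_hom[OF X(3)] Mult_module_hom[OF X(1)] o X Mult_Eta_left[OF X(1)] Id_Comp[OF e(3)] by simp
  have A: "?R X Y \<otimes> Id C Z \<in> Hom C (X \<odot> Y \<odot> Z) (?T Y \<odot> ?T X \<odot> Z)"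
    using TensorM_Hom[OF RXY Id_Hom[OF X(3)]] TensorO_assoc X o by simp
  note Im = TensorM_Hom[OF I(3) mu]
  have E: "Id C (?T Y \<odot> ?T Z) \<otimes> Mult T X = Id C (?T Y) \<otimes> (Id C (?T Z) \<otimes> Mult T X)"
    using TensorM_assoc[OF I(2,3) mu] TensorM_Id o by simp
  note Ie = TensorM_Hom[OF I(1) e(3)]
  have "(Id C (?T Y \<odot> ?T Z) \<otimes> Mult T X) \<cdot> (Id C (?T Y) \<otimes> ?R (?T X) Z) \<cdot> (?R X Y \<otimes> Id C Z)
      = (Id C (?T Y) \<otimes> (\<tau> (?F X) (?F Z) \<cdot> (Id C (?T X) \<otimes> Eta T Z))) \<cdot> (?R X Y \<otimes> Id C Z)"
    using tensor_comp_right(1)[OF RT Im I(2)] E K by simp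
  also have "\<dots> = (Id C (?T Y) \<otimes> \<tau> (?F X) (?F Z)) \<cdot> ((Id C (?T Y \<odot> ?T X) \<otimes> Eta T Z) \<cdot> (?R X Y \<otimes> Id C Z))"
    using tensor_comp_right(1)[OF Ie tXZ I(2)] TensorM_assoc[OF I(2,1) e(3)] TensorM_Id o
      Comp_assoc[OF A TensorM_Hom[OF I(2) Ie] TensorM_Hom[OF I(2) tXZ]] by simp
  also have "(Id C (?T Y \<odot> ?T X) \<otimes> Eta T Z) \<cdot> (?R X Y \<otimes> Id C Z) = ?R X Y \<otimes> Eta T Z"
    using TensorM_Comp[OF RXY Id_Hom[OF TensorO_Obj[OF o(2,1)]] Id_Hom[OF X(3)] e(3)]
      Id_Comp[OF RXY] Comp_Id[OF e(3)] by simp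
  also have "\<dots> = (\<tau> (?F X) (?F Y) \<otimes> Id C (?T Z)) \<cdot> (Eta T X \<otimes> (Eta T Y \<otimes> Eta T Z))"
    using tensor_comp_left(2)[OF TensorM_Hom[OF e(1,2)] tXY e(3)] R_matrix_of_apply[OF X(1,2)]
      TensorM_assoc[OF e] by simp
  finally have rhs: "(Id C (?T Y \<odot> ?T Z) \<otimes> Mult T X) \<cdot> (Id C (?T Y) \<otimes> ?R (?T X) Z) \<cdot> (?R X Y \<otimes> Id C Z)
    = (Id C (?T Y) \<otimes> \<tau> (?F X) (?F Z)) \<cdot> ((\<tau> (?F X) (?F Y) \<otimes> Id C (?T Z)) \<cdot> (Eta T X \<otimes> (Eta T Y \<otimes> Eta T Z)))" .
  have eee: "Eta T X \<otimes> (Eta T Y \<otimes> Eta T Z) \<in> Hom C (X \<odot> Y \<odot> Z) (?T X \<odot> ?T Y \<odot> ?T Z)"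
    using TensorM_Hom[OF e(1) TensorM_Hom[OF e(2,3)]] .
  have t1: "\<tau> (?F X) (?F Y) \<otimes> Id C (?T Z) \<in> Hom C (?T X \<odot> ?T Y \<odot> ?T Z) (?T Y \<odot> ?T X \<odot> ?T Z)"
    using TensorM_Hom[OF tXY I(3)] TensorO_assoc o by simp
  \<comment> \<open>Naturality in the second variable, for the comultiplication as a morphism from
    \<open>F (Y \<otimes> Z)\<close> to \<open>F Y \<otimes> F Z\<close>; by
    \<open>Comult_Eta\<close> its restriction along the unit is
    \<open>\<eta> \<otimes> \<eta>\<close>, and the swap now has a tensor product of modules as an
    argument, as the hexagon requires.\<close>
  have "(Comult T Y Z \<otimes> Id C (?T X)) \<cdot> ?R X (Y \<odot> Z)
      = \<tau> (?F X) (?F Y \<odot>\<^bsub>?D\<^esub> ?F Z) \<cdot> ((Id C (?T X) \<cdot> Eta T X) \<otimes> (Comult T Y Z \<cdot> Eta T (Y \<odot> Z)))"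
    using R_matrix_of_hom_natural[of "Id C (?T X)" X "fst (?F X)" "snd (?F X)" "Comult T Y Z" "Y \<odot> Z"
        "fst (?F Y \<odot>\<^bsub>?D\<^esub> ?F Z)" "snd (?F Y \<odot>\<^bsub>?D\<^esub> ?F Z)"]
      free_id_module_hom[OF X(1)] Comult_module_hom[OF X(2,3)] X TensorO_Obj by simp
  also have "\<dots> = ((Id C (?T Y) \<otimes> \<tau> (?F X) (?F Z)) \<cdot> (\<tau> (?F X) (?F Y) \<otimes> Id C (?T Z)))
      \<cdot> (Eta T X \<otimes> (Eta T Y \<otimes> Eta T Z))"
    using hexagon_right[of "?F X" "?F Y" "?F Z"] F Id_Comp[OF e(1)] Comult_Eta[OF X(2,3)]
    by (simp add: free_module_def)
  finally show ?thesis
    using rhs Comp_assoc[OF eee t1 TensorM_Hom[OF I(2) tXZ]] by simp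
qed

text \<open>The same comparison with the other hexagon: the comultiplication is used in the first
  variable, and the multiplication \<open>F (T Z) -> F Z\<close> in the second.\<close>

lemma R_matrix_of_tensor_left:
  assumes X: "X \<in> Obj C" "Y \<in> Obj C" "Z \<in> Obj C"
  shows "(Id C (MapO T Z) \<otimes> Comult T X Y) \<cdot> R_matrix_of C T \<tau> (X \<odot> Y) Z
    = (Mult T Z \<otimes> Id C (MapO T X \<odot> MapO T Y)) \<cdot> (R_matrix_of C T \<tau> X (MapO T Z) \<otimes> Id C (MapO T Y))
      \<cdot> (Id C X \<otimes> R_matrix_of C T \<tau> Y Z)"
proof -
  let ?R = "R_matrix_of C T \<tau>" and ?F = "free_module T" and ?T = "MapO T" and ?D = "module_category C T"
  have o: "?T X \<in> Obj C" "?T Y \<in> Obj C" "?T Z \<in> Obj C" using X MapO_Obj by auto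
  note I = Id_Hom[OF o(1)] Id_Hom[OF o(2)] Id_Hom[OF o(3)]
  note e = Eta_Hom[OF X(1)] Eta_Hom[OF X(2)] Eta_Hom[OF X(3)]
  note F = free_module_in_modules[OF X(1)] free_module_in_modules[OF X(2)] free_module_in_modules[OF X(3)]
  note tYZ = swap_free_Hom[OF X(2,3)] and tXZ = swap_free_Hom[OF X(1,3)]
  note RYZ = R_matrix_of_Hom[OF X(2,3)] and RT = R_matrix_of_Hom[OF X(1) o(3)] and mu = Mult_Hom[OF X(3)]
  have K: "(Mult T Z \<otimes> Id C (?T X)) \<cdot> ?R X (?T Z) = \<tau> (?F X) (?F Z) \<cdot> (Eta T X \<otimes> Id C (?T Z))"
    using R_matrix_of_hom_natural[of "Id C (?T X)" X "fst (?F X)" "snd (?F X)" "Mult T Z" "?T Z" "fst (?F Z)" "snd (?F Z)"]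
      free_id_module_hom[OF X(1)] Mult_module_hom[OF X(3)] o X Mult_Eta_left[OF X(3)] Id_Comp[OF e(1)] by simp
  have A: "Id C X \<otimes> ?R Y Z \<in> Hom C (X \<odot> Y \<odot> Z) ((X \<odot> ?T Z) \<odot> ?T Y)"
    using TensorM_Hom[OF Id_Hom[OF X(1)] RYZ] TensorO_assoc X o by simp
  note Im = TensorM_Hom[OF mu I(1)]
  have E: "Mult T Z \<otimes> Id C (?T X \<odot> ?T Y) = (Mult T Z \<otimes> Id C (?T X)) \<otimes> Id C (?T Y)"
    using TensorM_assoc[OF mu I(1,2)] TensorM_Id o by simp
  note Ie = TensorM_Hom[OF e(1) I(3)]
  have "(Mult T Z \<otimes> Id C (?T X \<odot> ?T Y)) \<cdot> (?R X (?T Z) \<otimes> Id C (?T Y)) \<cdot> (Id C X \<otimes> ?R Y Z)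
      = ((\<tau> (?F X) (?F Z) \<cdot> (Eta T X \<otimes> Id C (?T Z))) \<otimes> Id C (?T Y)) \<cdot> (Id C X \<otimes> ?R Y Z)"
    using tensor_comp_left(1)[OF RT Im I(2)] E K by simp
  also have "\<dots> = (\<tau> (?F X) (?F Z) \<otimes> Id C (?T Y)) \<cdot> ((Eta T X \<otimes> Id C (?T Z \<odot> ?T Y)) \<cdot> (Id C X \<otimes> ?R Y Z))"
    using tensor_comp_left(1)[OF Ie tXZ I(2)] TensorM_assoc[OF e(1) I(3,2)] TensorM_Id o
      Comp_assoc[OF A TensorM_Hom[OF Ie I(2)] TensorM_Hom[OF tXZ I(2)]] by simp
  also have "(Eta T X \<otimes> Id C (?T Z \<odot> ?T Y)) \<cdot> (Id C X \<otimes> ?R Y Z) = Eta T X \<otimes> ?R Y Z"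
    using TensorM_Comp[OF Id_Hom[OF X(1)] e(1) RYZ Id_Hom[OF TensorO_Obj[OF o(3,2)]]]
      Id_Comp[OF RYZ] Comp_Id[OF e(1)] by simp
  also have "\<dots> = (Id C (?T X) \<otimes> \<tau> (?F Y) (?F Z)) \<cdot> ((Eta T X \<otimes> Eta T Y) \<otimes> Eta T Z)"
    using tensor_comp_right(2)[OF TensorM_Hom[OF e(2,3)] tYZ e(1)] R_matrix_of_apply[OF X(2,3)]
      TensorM_assoc[OF e] by simp
  finally have rhs: "(Mult T Z \<otimes> Id C (?T X \<odot> ?T Y)) \<cdot> (?R X (?T Z) \<otimes> Id C (?T Y)) \<cdot> (Id C X \<otimes> ?R Y Z)
    = (\<tau> (?F X) (?F Z) \<otimes> Id C (?T Y)) \<cdot> ((Id C (?T X) \<otimes> \<tau> (?F Y) (?F Z)) \<cdot> ((Eta T X \<otimes> Eta T Y) \<otimes> Eta T Z))" .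
  have eee: "(Eta T X \<otimes> Eta T Y) \<otimes> Eta T Z \<in> Hom C (X \<odot> Y \<odot> Z) (?T X \<odot> ?T Y \<odot> ?T Z)"
    using TensorM_Hom[OF TensorM_Hom[OF e(1,2)] e(3)] TensorO_assoc X o by simp
  have t1: "Id C (?T X) \<otimes> \<tau> (?F Y) (?F Z) \<in> Hom C (?T X \<odot> ?T Y \<odot> ?T Z) ((?T X \<odot> ?T Z) \<odot> ?T Y)"
    using TensorM_Hom[OF I(1) tYZ] TensorO_assoc o by simp
  have "(Id C (?T Z) \<otimes> Comult T X Y) \<cdot> ?R (X \<odot> Y) Z
      = \<tau> (?F X \<odot>\<^bsub>?D\<^esub> ?F Y) (?F Z) \<cdot> ((Comult T X Y \<cdot> Eta T (X \<odot> Y)) \<otimes> (Id C (?T Z) \<cdot> Eta T Z))"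
    using R_matrix_of_hom_natural[of "Comult T X Y" "X \<odot> Y"
        "fst (?F X \<odot>\<^bsub>?D\<^esub> ?F Y)" "snd (?F X \<odot>\<^bsub>?D\<^esub> ?F Y)" "Id C (?T Z)" Z "fst (?F Z)" "snd (?F Z)"]
      free_id_module_hom[OF X(3)] Comult_module_hom[OF X(1,2)] X TensorO_Obj by simp
  also have "\<dots> = ((\<tau> (?F X) (?F Z) \<otimes> Id C (?T Y)) \<cdot> (Id C (?T X) \<otimes> \<tau> (?F Y) (?F Z)))
      \<cdot> ((Eta T X \<otimes> Eta T Y) \<otimes> Eta T Z)"
    using hexagon_left[of "?F X" "?F Y" "?F Z"] F Id_Comp[OF e(3)] Comult_Eta[OF X(1,2)]
    by (simp add: free_module_def)
  finally show ?thesis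
    using rhs Comp_assoc[OF eee t1 TensorM_Hom[OF tXZ I(2)]] by simp
qed

lemma R_matrix_of_R_matrix: "R_matrix C T (R_matrix_of C T \<tau>)"
proof (unfold_locales, goal_cases)
  case 1
  show ?case using R_matrix_of_Hom by (auto simp: R_matrix_of_def)
next
  case (2 f X X' g Y Y')
  then show ?case by (rule R_matrix_of_natural)
next
  case 3
  show ?case
    \<comment> \<open>The arguments are exchanged because the star-inverse at \<open>X\<close>,
      \<open>Y\<close> starts from \<open>Y \<otimes> X\<close>.\<close>
    by (rule exI[of _ "\<lambda>X Y. R_matrix_of C T inv_swap Y X"])
      (simp add: inv.R_matrix_of_Hom inv.R_matrix_of_natural inv_swap_cancel)
next
  case (4 X Y)
  then show ?case by (rule R_matrix_of_Comult)
next
  case (5 X Y Z)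
  then show ?case by (rule R_matrix_of_tensor_left)
next
  case (6 X Y Z)
  then show ?case by (rule R_matrix_of_tensor_right)
qed

text \<open>On modules this is \<open>R_matrix_of_action\<close>; extensionality in both arguments
  extends it to an equality of functions.\<close>

lemma braiding_of_R_matrix_of: "braiding_of C T (R_matrix_of C T \<tau>) = \<tau>"
proof -
  have "braiding_of C T (R_matrix_of C T \<tau>) A B = \<tau> A B" if "A \<in> modules C T" "B \<in> modules C T" for A B
    using R_matrix_of_action that by (cases A, cases B) (simp add: braiding_of_def)
  moreover have "\<tau> \<in> extensional (modules C T)" "\<And>A. A \<in> modules C T \<Longrightarrow> \<tau> A \<in> extensional (modules C T)"
    using family by (auto simp: PiE_def)
  moreover have "braiding_of C T (R_matrix_of C T \<tau>) \<in> extensional (modules C T)"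
    "\<And>A. A \<in> modules C T \<Longrightarrow> braiding_of C T (R_matrix_of C T \<tau>) A \<in> extensional (modules C T)"
    by (auto simp: braiding_of_def)
  ultimately show ?thesis
    by (intro extensionalityI[where A = "modules C T"])
qed

end

theorem theorem8p5:
  fixes C :: "('o, 'm) monoidal_data" and T :: "('o, 'm) bimonad_data"
  assumes "bimonad C T"
  shows "(\<forall>R. R_matrix C T R \<longrightarrow> braiding (module_category C T) (braiding_of C T R))
    \<and> bij_betw (braiding_of C T) {R. R_matrix C T R} {\<tau>. braiding (module_category C T) \<tau>}"
proof -
  have "module_braiding C T \<tau>" if "braiding (module_category C T) \<tau>" for \<tau>
    using assms that by (simp add: module_braiding_def)
  then show ?thesis
    by (auto intro!: bij_betw_byWitness[where f' = "R_matrix_of C T"] simp: R_matrix.braiding_braiding_of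
      R_matrix.R_matrix_of_braiding_of module_braiding.braiding_of_R_matrix_of module_braiding.R_matrix_of_R_matrix)
qed

end
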